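(* Let $d\ge 2$ and $1\le j\le d-1$ be integers, let $\chi_1,\dots,\chi_d$ be Dirichlet characters of the same modulus $q\ge2$, let $n\in\mathbb Z$, let $k_j',\dots,k_d'$ be non-negative integers, and put $$a_d(j):=-2k_d'(j)+k_d'(j)\frac{\log|Q|}{\log\alpha}+\left(\frac{2n}{q}+\ell_{Q,k_d'(j)}\right)\frac{\pi i}{\log\alpha}.$$ Then $$\underset{s_d(j)=a_d(j)}{\mathrm{Res}}\ \mathcal L_U^d(\mathbf s\mid\chi)=D^{a_d(j)/2}\sum_{r_1=1}^q\chi_1(r_1)\sum_{r_2=1}^q\chi_2(r_1+r_2)\cdots\sum_{r_d=1}^q\chi_d(r_1+\cdots+r_d)\ \zeta_U^{j-1}(s_1,\dots,s_{j-1}\mid r_1,\dots,r_{j-1})$$ $$\times\sum_{\substack{k_j\ge0,\dots,k_d\ge0\\ k_d(j)=k_d'(j)}}\binom{-s_j}{k_j}(-1)^{k_j}\cdots\binom{-s_d}{k_d}(-1)^{k_d}\ \left(\prod_{t=j+1}^{d}\frac{Q^{k_d(t)\,r_t}\,\alpha^{-r_t(s_d(t)+2k_d(t))}}{1-Q^{q k_d(t)}\alpha^{-q(s_d(t)+2k_d(t))}}\right)\frac{\zeta_q^{-n(r_1+\cdots+r_j)}}{q\log\alpha}.$$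
   Context: Standing assumptions: $P,Q$ are real numbers with $P>0$, $Q\ne 0$, $D:=P^2-4Q$, and $Q<P-1$ if $0<P\le 2$, $Q\le P-1$ if $P>2$. Let $\alpha,\beta$ be the roots of $x^2-Px+Q=0$, with $\alpha=(P+\sqrt D)/2$, $\beta=(P-\sqrt D)/2$, and let $U_n=(\alpha^n-\beta^n)/(\alpha-\beta)$ for $n\ge 0$ (Lucas sequence of the first kind). Complex powers of positive reals are taken with the real logarithm. $\zeta_q:=e^{2\pi i/q}$. Notation: $s_d(t):=s_t+\cdots+s_d$, $k_d(t):=k_t+\cdots+k_d$, $k_d'(t):=k_t'+\cdots+k_d'$. $\ell_{Q,k}:=0$ if $Q>0$ and $\ell_{Q,k}:=k$ if $Q<0$. For positive integers $r_1,\dots,r_e$, the multiple shifted Lucas zeta function of depth $e$ (with modulus $q$) is the meromorphic continuation to $\mathbb C^e$ of $$\zeta_U^e(s_1,\dots,s_e\mid r_1,\dots,r_e):=\sum_{n_1,\dots,n_e=0}^\infty \frac{1}{U_{qn_1+r_1}^{s_1}}\,\frac{1}{U_{q(n_1+n_2)+(r_1+r_2)}^{s_2}}\cdots\frac{1}{U_{q(n_1+\cdots+n_e)+(r_1+\cdots+r_e)}^{s_e}},$$ with $\zeta_U^0:=1$. The multiple Lucas $L$-function of depth $d$ is the meromorphic continuation to $\mathbb C^d$ of $$\mathcal L_U^d(\mathbf s\mid\chi)=\mathcal L_U^d(s_1,\dots,s_d\mid\chi_1,\dots,\chi_d):=\sum_{0<n_1<\cdots<n_d}\frac{\chi_1(n_1)}{U_{n_1}^{s_1}}\cdots\frac{\chi_d(n_d)}{U_{n_d}^{s_d}}.$$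 Both series (with $e=d$) converge absolutely for $(s_1,\dots,s_d)\in\mathbb C^d$ with $\sum_{i=j}^d\mathrm{Re}(s_i)>0$ for $1\le j\le d$. The residue along the hyperplane $s_d(j)=a_d(j)$ is the restriction of the meromorphic function $(s_d(j)-a_d(j))\,\mathcal L_U^d(\mathbf s\mid\chi)$ to that hyperplane. *)

theory Defs
  imports "HOL-Analysis.Analysis"
begin

text \<open>
  The dimension has to vary within one statement, so a point of \<open>\<complex>\<^sup>m\<close> is an extensional
  function on the index set \<open>{1..m}\<close>.
\<close>

definition Cn :: "nat \<Rightarrow> (nat \<Rightarrow> complex) topology" where
  "Cn m = product_topology (\<lambda>_. euclidean) {1..m}"

definition holo :: "nat \<Rightarrow> (nat \<Rightarrow> complex) set \<Rightarrow> ((nat \<Rightarrow> complex) \<Rightarrow> complex) \<Rightarrow> bool" where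
  "holo m W f \<longleftrightarrow>
     openin (Cn m) W \<and>
     continuous_map (subtopology (Cn m) W) euclidean f \<and>
     (\<forall>z\<in>W. \<forall>i\<in>{1..m}. (\<lambda>w. f (z(i := w))) field_differentiable at (z i))"

text \<open>
  A meromorphic function is represented by a total function that is locally a quotient \<open>g / h\<close>
  of holomorphic functions wherever \<open>h\<close> does not vanish; its values on the
  nowhere dense exceptional set are irrelevant.
\<close>

definition meromorphic_Cn :: "nat \<Rightarrow> ((nat \<Rightarrow> complex) \<Rightarrow> complex) \<Rightarrow> bool" where
  "meromorphic_Cn m f \<longleftrightarrow>
     (\<forall>p \<in> topspace (Cn m). \<exists>W g h. p \<in> W \<and> holo m W g \<and> holo m W h \<and>
        (\<forall>V. openin (Cn m) V \<and> V \<subseteq> W \<and> V \<noteq> {} \<longrightarrow> (\<exists>z\<in>V. h z \<noteq> 0)) \<and>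
        (\<forall>z\<in>W. h z \<noteq> 0 \<longrightarrow> f z = g z / h z))"

definition dense_open_in :: "'a topology \<Rightarrow> 'a set \<Rightarrow> bool" where
  "dense_open_in X V \<longleftrightarrow> openin X V \<and> X closure_of V = topspace X"

text \<open>
  By the identity theorem a meromorphic continuation from a nonempty open set \<open>S\<close> is unique
  as a meromorphic function, that is, up to the values on a nowhere dense set. The choice
  operator picks a representative; all notions below depend only on its class.
\<close>

definition meromorphic_continuation ::
  "nat \<Rightarrow> (nat \<Rightarrow> complex) set \<Rightarrow> ((nat \<Rightarrow> complex) \<Rightarrow> complex) \<Rightarrow> (nat \<Rightarrow> complex) \<Rightarrow> complex" where
  "meromorphic_continuation m S f = (SOME F. meromorphic_Cn m F \<and> (\<forall>s\<in>S. F s = f s))"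

definition tail_hyperplane :: "nat \<Rightarrow> nat \<Rightarrow> complex \<Rightarrow> (nat \<Rightarrow> complex) set" where
  "tail_hyperplane d j a = {s \<in> topspace (Cn d). (\<Sum>i=j..d. s i) = a}"

text \<open>
  \<open>G\<close> is the product \<open>(s\<^sub>j + \<dots> + s\<^sub>d - a) F\<close> as a meromorphic function. Its
  restriction to the hyperplane makes sense because \<open>G\<close> is required to be holomorphic near
  the points of a dense relatively open subset of the hyperplane; that this restriction equals \<open>R\<close>
  as a meromorphic function on the hyperplane means that both agree on such a subset.
\<close>

definition has_residue_along ::
  "((nat \<Rightarrow> complex) \<Rightarrow> complex) \<Rightarrow> ((nat \<Rightarrow> complex) \<Rightarrow> complex) \<Rightarrow> nat \<Rightarrow> nat \<Rightarrow> complex \<Rightarrow> bool" where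
  "has_residue_along F R d j a \<longleftrightarrow>
     (\<exists>G. meromorphic_Cn d G \<and>
        (\<exists>V. dense_open_in (Cn d) V \<and> (\<forall>s\<in>V. G s = ((\<Sum>i=j..d. s i) - a) * F s)) \<and>
        (\<exists>V. dense_open_in (subtopology (Cn d) (tail_hyperplane d j a)) V \<and>
             (\<forall>s\<in>V. (\<exists>W. s \<in> W \<and> holo d W G) \<and> G s = R s)))"

definition dirichlet_character :: "nat \<Rightarrow> (int \<Rightarrow> complex) \<Rightarrow> bool" where
  "dirichlet_character q chi \<longleftrightarrow>
     (\<forall>a b. chi (a * b) = chi a * chi b) \<and>
     (\<forall>a. chi (a + int q) = chi a) \<and>
     (\<forall>a. chi a = 0 \<longleftrightarrow> \<not> coprime a (int q))"

definition lucas_disc :: "real \<Rightarrow> real \<Rightarrow> real" where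
  "lucas_disc P Q = P\<^sup>2 - 4 * Q"

definition lucas_alpha :: "real \<Rightarrow> real \<Rightarrow> real" where
  "lucas_alpha P Q = (P + sqrt (lucas_disc P Q)) / 2"

definition lucas_beta :: "real \<Rightarrow> real \<Rightarrow> real" where
  "lucas_beta P Q = (P - sqrt (lucas_disc P Q)) / 2"

definition lucas_U :: "real \<Rightarrow> real \<Rightarrow> nat \<Rightarrow> real" where
  "lucas_U P Q n =
     (lucas_alpha P Q ^ n - lucas_beta P Q ^ n) / (lucas_alpha P Q - lucas_beta P Q)"

definition conv_domain :: "nat \<Rightarrow> (nat \<Rightarrow> complex) set" where
  "conv_domain m = {s \<in> topspace (Cn m). \<forall>j\<in>{1..m}. (\<Sum>i=j..m. Re (s i)) > 0}"

definition lucas_zeta_series ::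
  "real \<Rightarrow> real \<Rightarrow> nat \<Rightarrow> nat \<Rightarrow> (nat \<Rightarrow> nat) \<Rightarrow> (nat \<Rightarrow> complex) \<Rightarrow> complex" where
  "lucas_zeta_series P Q q e r s =
     (\<Sum>\<^sub>\<infinity>n \<in> {1..e} \<rightarrow>\<^sub>E (UNIV :: nat set).
        \<Prod>t=1..e. 1 / of_real (lucas_U P Q (q * (\<Sum>i=1..t. n i) + (\<Sum>i=1..t. r i))) powr s t)"

definition lucas_zeta ::
  "real \<Rightarrow> real \<Rightarrow> nat \<Rightarrow> nat \<Rightarrow> (nat \<Rightarrow> nat) \<Rightarrow> (nat \<Rightarrow> complex) \<Rightarrow> complex" where
  "lucas_zeta P Q q e r =
     (if e = 0 then (\<lambda>_. 1)
      else meromorphic_continuation e (conv_domain e) (lucas_zeta_series P Q q e r))"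

definition lucas_L_series ::
  "real \<Rightarrow> real \<Rightarrow> nat \<Rightarrow> (nat \<Rightarrow> int \<Rightarrow> complex) \<Rightarrow> (nat \<Rightarrow> complex) \<Rightarrow> complex" where
  "lucas_L_series P Q d chi s =
     (\<Sum>\<^sub>\<infinity>n \<in> {n \<in> {1..d} \<rightarrow>\<^sub>E {0<..}. strict_mono_on {1..d} n}.
        \<Prod>t=1..d. chi t (int (n t)) / of_real (lucas_U P Q (n t)) powr s t)"

definition lucas_L ::
  "real \<Rightarrow> real \<Rightarrow> nat \<Rightarrow> (nat \<Rightarrow> int \<Rightarrow> complex) \<Rightarrow> (nat \<Rightarrow> complex) \<Rightarrow> complex" where
  "lucas_L P Q d chi = meromorphic_continuation d (conv_domain d) (lucas_L_series P Q d chi)"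

definition ell :: "real \<Rightarrow> nat \<Rightarrow> nat" where
  "ell Q k = (if Q < 0 then k else 0)"

definition root_of_unity :: "nat \<Rightarrow> complex" where
  "root_of_unity q = exp (2 * of_real pi * \<i> / of_nat q)"

text \<open>The location of the pole, as a function of \<open>K = k'\<^sub>j + \<dots> + k'\<^sub>d\<close>.\<close>

definition pole_value :: "real \<Rightarrow> real \<Rightarrow> nat \<Rightarrow> int \<Rightarrow> nat \<Rightarrow> complex" where
  "pole_value P Q q n K =
     - 2 * of_nat K + of_nat K * of_real (ln \<bar>Q\<bar> / ln (lucas_alpha P Q)) +
     (2 * of_int n / of_nat q + of_nat (ell Q K)) * (of_real pi * \<i> / of_real (ln (lucas_alpha P Q)))"

end

theory Submission
  imports Defs "HOL-Complex_Analysis.Complex_Analysis"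
begin

text \<open>
  With \<open>\<rho> = \<beta> / \<alpha> = Q / \<alpha>\<^sup>2\<close> one has \<open>U\<^sub>n = \<alpha>\<^sup>n (1 - \<rho>\<^sup>n) / sqrt D\<close> and \<open>\<bar>\<rho>\<bar> < 1\<close>. Expanding every
  \<open>(1 - \<rho>\<^sup>n)\<^sup>-\<^sup>s\<close> by the binomial series, splitting the increments of the summation indices into residues
  \<open>r\<^sub>t\<close> modulo \<open>q\<close>, and summing the geometric progressions turns the \<open>L\<close>-series into a finite
  combination, over \<open>r\<close>, of series over the binomial exponents \<open>k\<close>, whose terms are products of factors
  \<open>x\<^sup>r / (1 - x\<^sup>q)\<close> with \<open>x = \<rho>\<^sup>K \<alpha>\<^sup>-\<^sup>w\<close>, where \<open>K\<close> and \<open>w\<close> are tail sums of \<open>k\<close> and \<open>s\<close>. Since \<open>\<bar>x\<bar>\<close> is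
  \<open>O(\<bar>\<rho>\<bar>\<^sup>K)\<close> locally uniformly in \<open>w\<close>, these series converge locally uniformly after multiplication
  by finitely many linear factors, so they are the meromorphic continuation. On the hyperplane where the
  \<open>j\<close>-th tail sum of \<open>s\<close> is \<open>a\<close>, only the terms with a single value of the \<open>j\<close>-th tail sum of \<open>k\<close> have
  a pole, because \<open>K\<close> is determined by \<open>\<bar>x\<bar> = 1\<close>. The factors with index below \<open>j\<close> then reassemble
  into the zeta function of depth \<open>j - 1\<close>, and the sum over the remaining exponents is finite.
\<close>

subsection \<open>The topology of \<open>\<complex>\<^sup>m\<close>\<close>

lemma topspace_Cn [simp]: "topspace (Cn m) = {1..m} \<rightarrow>\<^sub>E UNIV"
  by (simp add: Cn_def)

lemma continuous_map_Cn_coord: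
  "i \<in> {1..m} \<Longrightarrow> continuous_map (Cn m) euclidean (\<lambda>z. z i)"
  unfolding Cn_def by (rule continuous_map_product_projection)

lemma continuous_map_into_Cn:
  assumes "\<And>i. i \<in> {1..m} \<Longrightarrow> continuous_map X euclidean (\<lambda>x. f x i)"
    and "\<And>i x. i \<notin> {1..m} \<Longrightarrow> x \<in> topspace X \<Longrightarrow> f x i = undefined"
  shows "continuous_map X (Cn m) f"
  unfolding Cn_def by (rule continuous_map_coordinatewise_then_product) (use assms in auto)

lemma continuous_map_complex_mult:
  fixes f g :: "'a \<Rightarrow> complex"
  shows "continuous_map X euclidean f \<Longrightarrow> continuous_map X euclidean g
    \<Longrightarrow> continuous_map X euclidean (\<lambda>x. f x * g x)"
  by (simp add: continuous_map_atin tendsto_mult)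

lemma openin_Cn_box:
  assumes "\<And>i. i \<in> {1..m} \<Longrightarrow> open (U i)"
  shows "openin (Cn m) (PiE {1..m} U)"
  unfolding Cn_def by (subst openin_PiE_gen) (use assms in auto)

lemma openin_Cn_imp_box:
  assumes "openin (Cn m) W" "p \<in> W"
  obtains e where "e > 0" "PiE {1..m} (\<lambda>i. ball (p i) e) \<subseteq> W"
proof -
  obtain U where U: "\<And>i. i \<in> {1..m} \<Longrightarrow> open (U i)" "p \<in> PiE {1..m} U" "PiE {1..m} U \<subseteq> W"
  proof -
    have "\<exists>U. (\<forall>i \<in> {1..m}. openin euclidean (U i)) \<and> p \<in> PiE {1..m} U \<and> PiE {1..m} U \<subseteq> W"
      using assms unfolding Cn_def openin_product_topology_alt by meson
    then show ?thesis using that unfolding open_openin[symmetric] by metis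
  qed
  have "\<exists>e>0. ball (p i) e \<subseteq> U i" if "i \<in> {1..m}" for i
    using U that by (meson PiE_mem openE)
  then obtain e where e: "\<And>i. i \<in> {1..m} \<Longrightarrow> e i > 0 \<and> ball (p i) (e i) \<subseteq> U i"
    by metis
  \<comment> \<open>The extra element \<open>1\<close> keeps the minimum over a nonempty set when
    \<open>m = 0\<close>.\<close>
  define e' where "e' = Min (insert 1 (e ` {1..m}))"
  have "e' > 0" using e by (auto simp: e'_def)
  moreover have "ball (p i) e' \<subseteq> U i" if "i \<in> {1..m}" for i
  proof -
    have "e' \<le> e i" unfolding e'_def using that by (intro Min_le) auto
    then show ?thesis using e[OF that] by auto
  qed
  then have "PiE {1..m} (\<lambda>i. ball (p i) e') \<subseteq> PiE {1..m} U"
    by (intro PiE_mono)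
  then have "PiE {1..m} (\<lambda>i. ball (p i) e') \<subseteq> W" using U(3) by (rule subset_trans)
  ultimately show ?thesis by (rule that)
qed

lemma openin_Cn_imp_coord_ball:
  assumes "openin (Cn m) W" "z \<in> W" "i \<in> {1..m}"
  obtains e where "e > 0" "\<And>w. w \<in> ball (z i) e \<Longrightarrow> z(i := w) \<in> W"
proof -
  obtain e where e: "e > 0" "PiE {1..m} (\<lambda>i. ball (z i) e) \<subseteq> W"
    using openin_Cn_imp_box[OF assms(1,2)] .
  have z: "z \<in> topspace (Cn m)" using assms openin_subset by blast
  have "z(i := w) \<in> PiE {1..m} (\<lambda>i. ball (z i) e)" if "w \<in> ball (z i) e" for w
  proof (rule PiE_I)
    show "(z(i := w)) k \<in> ball (z k) e" for k
      using that e(1) by (cases "k = i") auto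
    show "(z(i := w)) k = undefined" if "k \<notin> {1..m}" for k
      using z that assms(3) by (cases "k = i") (auto simp: PiE_def extensional_def)
  qed
  then have "z(i := w) \<in> W" if "w \<in> ball (z i) e" for w
    using subsetD[OF e(2)] that by blast
  with e(1) show ?thesis by (rule that)
qed

lemma dense_open_in_iff:
  "dense_open_in X V \<longleftrightarrow> openin X V \<and> (\<forall>T. openin X T \<and> T \<noteq> {} \<longrightarrow> (\<exists>z\<in>T. z \<in> V))"
  unfolding dense_open_in_def dense_intersects_open by blast

lemma dense_open_in_topspace: "dense_open_in X (topspace X)"
  by (simp add: dense_open_in_def)

lemma dense_open_in_Int:
  assumes "dense_open_in X U" "dense_open_in X V"
  shows "dense_open_in X (U \<inter> V)"
  unfolding dense_open_in_iff
proof (intro conjI allI impI)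
  show "openin X (U \<inter> V)" using assms by (auto simp: dense_open_in_def)
next
  fix T assume T: "openin X T \<and> T \<noteq> {}"
  then obtain z where "z \<in> T" "z \<in> U" using assms(1) by (auto simp: dense_open_in_iff)
  then have "openin X (T \<inter> U)" "T \<inter> U \<noteq> {}"
    using T assms by (auto simp: dense_open_in_def)
  then show "\<exists>z\<in>T. z \<in> U \<inter> V" using assms(2) by (fastforce simp: dense_open_in_iff)
qed

text \<open>Intersecting with the whole space covers an empty index set, whose plain intersection
  would be \<open>UNIV\<close>.\<close>

lemma dense_open_in_INT:
  assumes "finite I" "\<And>i. i \<in> I \<Longrightarrow> dense_open_in X (V i)"
  shows "dense_open_in X (topspace X \<inter> (\<Inter>i\<in>I. V i))"
  using assms
proof (induction I rule: finite_induct)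
  case empty
  then show ?case by (simp add: dense_open_in_topspace)
next
  case (insert x F)
  have "topspace X \<inter> (\<Inter>i\<in>insert x F. V i) = V x \<inter> (topspace X \<inter> (\<Inter>i\<in>F. V i))" by auto
  then show ?case using insert by (auto intro: dense_open_in_Int)
qed

subsection \<open>Holomorphic functions of several variables\<close>

lemma holo_openin: "holo m W f \<Longrightarrow> openin (Cn m) W"
  by (simp add: holo_def)

lemma holo_subset:
  assumes "holo m W f" "openin (Cn m) V" "V \<subseteq> W"
  shows "holo m V f"
  using assms continuous_map_from_subtopology_mono by (fastforce simp: holo_def)

lemma holo_const: "openin (Cn m) W \<Longrightarrow> holo m W (\<lambda>_. c)"
  by (simp add: holo_def)

lemma holo_coord:
  assumes "openin (Cn m) W" "i \<in> {1..m}"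
  shows "holo m W (\<lambda>z. z i)"
  unfolding holo_def
proof (intro conjI ballI)
  show "continuous_map (subtopology (Cn m) W) euclidean (\<lambda>z. z i)"
    by (intro continuous_map_from_subtopology continuous_map_Cn_coord assms)
  fix z k assume "k \<in> {1..m}"
  show "(\<lambda>w. (z(k := w)) i) field_differentiable at (z k)"
    by (cases "i = k") (auto intro: field_differentiable_ident)
qed (use assms in auto)

lemma holo_add: "holo m W f \<Longrightarrow> holo m W g \<Longrightarrow> holo m W (\<lambda>z. f z + g z)"
  by (auto simp: holo_def intro!: continuous_map_add field_differentiable_add)

lemma holo_diff: "holo m W f \<Longrightarrow> holo m W g \<Longrightarrow> holo m W (\<lambda>z. f z - g z)"
  by (auto simp: holo_def intro!: continuous_map_diff field_differentiable_diff)

lemma holo_mult: "holo m W f \<Longrightarrow> holo m W g \<Longrightarrow> holo m W (\<lambda>z. f z * g z)"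
  by (auto simp: holo_def intro!: continuous_map_complex_mult field_differentiable_mult)

lemma holo_sum:
  "openin (Cn m) W \<Longrightarrow> (\<And>i. i \<in> I \<Longrightarrow> holo m W (f i)) \<Longrightarrow> holo m W (\<lambda>z. \<Sum>i\<in>I. f i z)"
  by (induction I rule: infinite_finite_induct) (auto intro: holo_const holo_add)

lemma holo_prod:
  "openin (Cn m) W \<Longrightarrow> (\<And>i. i \<in> I \<Longrightarrow> holo m W (f i)) \<Longrightarrow> holo m W (\<lambda>z. \<Prod>i\<in>I. f i z)"
  by (induction I rule: infinite_finite_induct) (auto intro: holo_const holo_mult)

lemma holo_compose:
  assumes f: "holo m W f" and g: "g holomorphic_on T" "open T" "\<And>z. z \<in> W \<Longrightarrow> f z \<in> T"
  shows "holo m W (\<lambda>z. g (f z))"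
  unfolding holo_def
proof (intro conjI ballI)
  show "openin (Cn m) W" using f holo_openin by blast
  have "continuous_map (subtopology (Cn m) W) (top_of_set T) f"
    using f g(3) by (auto simp: holo_def continuous_map_in_subtopology)
  moreover have "continuous_map (top_of_set T) euclidean g"
    using holomorphic_on_imp_continuous_on[OF g(1)] by simp
  ultimately show "continuous_map (subtopology (Cn m) W) euclidean (\<lambda>z. g (f z))"
    using continuous_map_compose[of _ _ f _ g] by (simp add: o_def)
  fix z i assume z: "z \<in> W" and i: "i \<in> {1..m}"
  have "(\<lambda>w. f (z(i := w))) field_differentiable at (z i)"
    using f z i by (auto simp: holo_def)
  moreover have "g field_differentiable at (f (z(i := z i)))"
    using g z by (simp add: holomorphic_on_imp_differentiable_at)
  ultimately show "(\<lambda>w. g (f (z(i := w)))) field_differentiable at (z i)"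
    using field_differentiable_compose[of "\<lambda>w. f (z(i := w))" "z i" g] by (simp add: o_def)
qed

text \<open>Freezing all coordinates but one is the bridge to one-variable complex analysis.\<close>

lemma holo_imp_holomorphic_coord:
  assumes "holo m W f" "\<And>w. w \<in> T \<Longrightarrow> z(i := w) \<in> W" "i \<in> {1..m}"
  shows "(\<lambda>w. f (z(i := w))) holomorphic_on T"
  unfolding holomorphic_on_def
proof
  fix w assume w: "w \<in> T"
  have "(\<lambda>u. f ((z(i := w))(i := u))) field_differentiable at ((z(i := w)) i)"
    using assms(1,3) assms(2)[OF w] unfolding holo_def by blast
  then show "(\<lambda>u. f (z(i := u))) field_differentiable at w within T"
    by (simp add: field_differentiable_at_within)
qed

text \<open>The Weierstrass M-test gives uniform convergence on \<open>W\<close>. Uniform limits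
  preserve continuity and, on each coordinate disc, holomorphy.\<close>

lemma holo_infsum:
  fixes f :: "'a \<Rightarrow> (nat \<Rightarrow> complex) \<Rightarrow> complex"
  assumes W: "openin (Cn m) W"
    and f: "\<And>k. k \<in> A \<Longrightarrow> holo m W (f k)"
    and bd: "\<And>k z. k \<in> A \<Longrightarrow> z \<in> W \<Longrightarrow> norm (f k z) \<le> M k"
    and M: "M summable_on A"
  shows "holo m W (\<lambda>z. \<Sum>\<^sub>\<infinity>k\<in>A. f k z)"
proof -
  have ul: "uniform_limit W (\<lambda>X y. \<Sum>x\<in>X. f x y) (\<lambda>y. \<Sum>\<^sub>\<infinity>x\<in>A. f x y) (finite_subsets_at_top A)"
    by (rule Weierstrass_m_test_general[OF bd M])
  have ev: "\<forall>\<^sub>F X in finite_subsets_at_top A. holo m W (\<lambda>z. \<Sum>k\<in>X. f k z)"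
    by (rule eventually_finite_subsets_at_top_weakI) (auto intro!: holo_sum W f)
  show ?thesis
    unfolding holo_def
  proof (intro conjI ballI W)
    have "continuous_map (subtopology (Cn m) W) (Met_TC.mtopology) (\<lambda>z. \<Sum>\<^sub>\<infinity>k\<in>A. f k z)"
    proof (rule Met_TC.continuous_map_uniform_limit)
      show "\<forall>\<^sub>F X in finite_subsets_at_top A.
          continuous_map (subtopology (Cn m) W) (Met_TC.mtopology) (\<lambda>z. \<Sum>k\<in>X. f k z)"
        using ev by eventually_elim (simp add: holo_def)
      fix e :: real assume "e > 0"
      then show "\<forall>\<^sub>F X in finite_subsets_at_top A. \<forall>x\<in>topspace (subtopology (Cn m) W).
          infsum (\<lambda>k. f k x) A \<in> UNIV \<and> dist (\<Sum>k\<in>X. f k x) (infsum (\<lambda>k. f k x) A) < e"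
        by (intro eventually_mono[OF uniform_limitD[OF ul \<open>e > 0\<close>]]) auto
    qed auto
    then show "continuous_map (subtopology (Cn m) W) euclidean (\<lambda>z. \<Sum>\<^sub>\<infinity>k\<in>A. f k z)"
      by (simp add: mtopology_is_euclidean)
  next
    fix z i assume z: "z \<in> W" and i: "i \<in> {1..m}"
    obtain e where e: "e > 0" "\<And>w. w \<in> ball (z i) e \<Longrightarrow> z(i := w) \<in> W"
      using openin_Cn_imp_coord_ball[OF W z i] by blast
    define F where "F w = (\<Sum>\<^sub>\<infinity>k\<in>A. f k (z(i := w)))" for w
    \<comment> \<open>Half the radius leaves a closed disc inside \<open>W\<close>, since the
      theorem on uniform limits asks for continuity up to the boundary circle.\<close>
    have in_W: "z(i := w) \<in> W" if "w \<in> cball (z i) (e/2)" for w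
      using that e by (intro e(2)) auto
    have "F holomorphic_on ball (z i) (e/2)"
    proof (rule holomorphic_uniform_limit)
      show "\<forall>\<^sub>F X in finite_subsets_at_top A.
          continuous_on (cball (z i) (e/2)) (\<lambda>w. \<Sum>k\<in>X. f k (z(i := w))) \<and>
          (\<lambda>w. \<Sum>k\<in>X. f k (z(i := w))) holomorphic_on ball (z i) (e/2)"
        using ev
      proof eventually_elim
        case (elim X)
        have "(\<lambda>w. \<Sum>k\<in>X. f k (z(i := w))) holomorphic_on cball (z i) (e/2)"
          by (rule holo_imp_holomorphic_coord[OF elim in_W i])
        then show ?case
          by (meson ball_subset_cball holomorphic_on_imp_continuous_on holomorphic_on_subset)
      qed
      show "uniform_limit (cball (z i) (e/2)) (\<lambda>X w. \<Sum>k\<in>X. f k (z(i := w))) F (finite_subsets_at_top A)"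
        unfolding F_def by (rule Weierstrass_m_test_general[OF _ M]) (use bd in_W in auto)
    qed auto
    then show "(\<lambda>w. \<Sum>\<^sub>\<infinity>k\<in>A. f k (z(i := w))) field_differentiable at (z i)"
      unfolding F_def using e(1) by (auto intro: holomorphic_on_imp_differentiable_at[of _ "ball (z i) (e/2)"])
  qed
qed

text \<open>The coordinates are moved one at a time, so that only the one-variable identity theorem enters.\<close>

lemma holo_box_identity:
  assumes f: "holo m W f" and W: "W = PiE {1..m} (\<lambda>i. ball (p i) e)"
    and V: "openin (Cn m) V" "V \<subseteq> W" "V \<noteq> {}" "\<And>z. z \<in> V \<Longrightarrow> f z = 0"
    and z: "z \<in> W"
  shows "f z = 0"
proof -
  obtain c where c: "c \<in> V" using V by auto
  obtain \<delta> where \<delta>: "\<delta> > 0" "PiE {1..m} (\<lambda>i. ball (c i) \<delta>) \<subseteq> V"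
    using openin_Cn_imp_box[OF V(1) c] .
  \<comment> \<open>Changing one coordinate of \<open>c\<close> stays in the small box, hence in
    \<open>W\<close>, so each small disc lies in the corresponding large one.\<close>
  have sub: "ball (c i) \<delta> \<subseteq> ball (p i) e" if i: "i \<in> {1..m}" for i
  proof
    fix w assume w: "w \<in> ball (c i) \<delta>"
    have "c \<in> PiE {1..m} (\<lambda>i. ball (p i) e)" using c V W by auto
    then have "c(i := w) \<in> PiE {1..m} (\<lambda>i. ball (c i) \<delta>)"
      using w i \<delta>(1) by (auto simp: PiE_def extensional_def)
    then have "c(i := w) \<in> PiE {1..m} (\<lambda>i. ball (p i) e)" using \<delta>(2) V(2) W by auto
    then show "w \<in> ball (p i) e" using i by (metis PiE_mem fun_upd_same)
  qed
  \<comment> \<open>At stage \<open>l\<close> the first \<open>l\<close> coordinates range over the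
    large discs and the rest stay in the small ones; stage \<open>0\<close> is the hypothesis on
    \<open>V\<close>, stage \<open>m\<close> the claim.\<close>
  have "\<forall>z\<in>W. (\<forall>i\<in>{l<..m}. z i \<in> ball (c i) \<delta>) \<longrightarrow> f z = 0" if "l \<le> m" for l
    using that
  proof (induction l)
    case 0
    show ?case
    proof (intro ballI impI)
      fix z assume "z \<in> W" "\<forall>i\<in>{0<..m}. z i \<in> ball (c i) \<delta>"
      then have "z \<in> PiE {1..m} (\<lambda>i. ball (c i) \<delta>)"
        unfolding W by (auto simp: PiE_def)
      then show "f z = 0" using \<delta>(2) V(4) by blast
    qed
  next
    case (Suc l)
    show ?case
    proof (intro ballI impI)
      fix z assume z: "z \<in> W" "\<forall>i\<in>{Suc l<..m}. z i \<in> ball (c i) \<delta>"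
      let ?i = "Suc l"
      have i: "?i \<in> {1..m}" using Suc by auto
      have inW: "z(?i := w) \<in> W" if "w \<in> ball (p ?i) e" for w
        using z(1) that i unfolding W by (auto simp: PiE_def extensional_def)
      have "f (z(?i := z ?i)) = 0"
      proof (rule analytic_continuation_open[where f = "\<lambda>w. f (z(?i := w))" and g = "\<lambda>_. 0"
            and s = "ball (c ?i) \<delta>" and s' = "ball (p ?i) e"])
        show "(\<lambda>w. f (z(?i := w))) holomorphic_on ball (p ?i) e"
          by (rule holo_imp_holomorphic_coord[OF f inW i])
        show "f (z(?i := w)) = 0" if "w \<in> ball (c ?i) \<delta>" for w
        proof -
          have "z(?i := w) \<in> W" using inW sub[OF i] that by blast
          moreover have "\<forall>k\<in>{l<..m}. (z(?i := w)) k \<in> ball (c k) \<delta>"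
            using z(2) that by auto
          ultimately show ?thesis using Suc by (meson Suc_leD)
        qed
        show "z ?i \<in> ball (p ?i) e" using z(1) i unfolding W by auto
      qed (use sub[OF i] \<delta>(1) in auto)
      then show "f z = 0" by simp
    qed
  qed
  from this[of m] show ?thesis using z by auto
qed

text \<open>The nonvanishing set of a continuous function is open, so if it were nonempty it would
  have to contain a zero.\<close>

lemma holo_continuous_zero_dense:
  assumes f: "holo m W f" and d: "\<And>T. openin (Cn m) T \<Longrightarrow> T \<noteq> {} \<Longrightarrow> T \<subseteq> W \<Longrightarrow> \<exists>z\<in>T. f z = 0"
    and z: "z \<in> W"
  shows "f z = 0"
proof (rule ccontr)
  assume nz: "f z \<noteq> 0"
  have "openin (subtopology (Cn m) W) {x \<in> topspace (subtopology (Cn m) W). f x \<in> -{0}}"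
    using f unfolding holo_def by (intro openin_continuous_map_preimage[where Y = euclidean]) auto
  then have "openin (Cn m) {x \<in> topspace (subtopology (Cn m) W). f x \<in> -{0}}"
    using holo_openin[OF f] openin_open_subtopology by blast
  moreover have "z \<in> {x \<in> topspace (subtopology (Cn m) W). f x \<in> -{0}}"
    using z nz openin_subset[OF holo_openin[OF f]] by auto
  ultimately show False using d by fastforce
qed

lemma holo_nonzero_open:
  assumes "holo m W f" "openin (Cn m) V" "V \<subseteq> W"
  shows "openin (Cn m) {z \<in> V. f z \<noteq> 0}"
proof -
  have "continuous_map (subtopology (Cn m) V) euclidean f"
    using holo_subset[OF assms] by (simp add: holo_def)
  then have "openin (subtopology (Cn m) V) {x \<in> topspace (subtopology (Cn m) V). f x \<in> -{0}}"
    by (intro openin_continuous_map_preimage[where Y = euclidean]) auto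
  then have "openin (Cn m) {x \<in> topspace (subtopology (Cn m) V). f x \<in> -{0}}"
    using assms(2) openin_open_subtopology by blast
  moreover have "{x \<in> topspace (subtopology (Cn m) V). f x \<in> -{0}} = {z \<in> V. f z \<noteq> 0}"
    using openin_subset[OF assms(2)] by auto
  ultimately show ?thesis by simp
qed

subsection \<open>The identity theorem for meromorphic functions\<close>

text \<open>A product of connected spaces is connected; the clopen argument for uniqueness rests on
  this.\<close>

lemma connected_space_Cn: "connected_space (Cn m)"
  unfolding Cn_def connected_space_product_topology
  by (metis connected_UNIV connected_space_subtopology subtopology_UNIV connectedin_iff_connected)

definition local_quotient ::
  "nat \<Rightarrow> ((nat \<Rightarrow> complex) \<Rightarrow> complex) \<Rightarrow> (nat \<Rightarrow> complex) set \<Rightarrow>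
    ((nat \<Rightarrow> complex) \<Rightarrow> complex) \<Rightarrow> ((nat \<Rightarrow> complex) \<Rightarrow> complex) \<Rightarrow> bool" where
  "local_quotient m f W g h \<longleftrightarrow> holo m W g \<and> holo m W h \<and>
     (\<forall>V. openin (Cn m) V \<and> V \<subseteq> W \<and> V \<noteq> {} \<longrightarrow> (\<exists>z\<in>V. h z \<noteq> 0)) \<and>
     (\<forall>z\<in>W. h z \<noteq> 0 \<longrightarrow> f z = g z / h z)"

lemma meromorphic_Cn_iff_local_quotient:
  "meromorphic_Cn m f \<longleftrightarrow> (\<forall>p\<in>topspace (Cn m). \<exists>W g h. p \<in> W \<and> local_quotient m f W g h)"
  by (simp only: meromorphic_Cn_def local_quotient_def)

lemma local_quotientD:
  assumes "local_quotient m f W g h"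
  shows "holo m W g" "holo m W h"
    "\<And>V. openin (Cn m) V \<Longrightarrow> V \<subseteq> W \<Longrightarrow> V \<noteq> {} \<Longrightarrow> \<exists>z\<in>V. h z \<noteq> 0"
    "\<And>z. z \<in> W \<Longrightarrow> h z \<noteq> 0 \<Longrightarrow> f z = g z / h z"
  using assms by (auto simp: local_quotient_def)

text \<open>Shrinking to a box about \<open>p\<close> makes the box form of the identity theorem
  applicable.\<close>

lemma meromorphic_Cn_local_box:
  assumes "meromorphic_Cn m f" "openin (Cn m) U" "p \<in> U"
  obtains W g h e where "W = PiE {1..m} (\<lambda>i. ball (p i) e)" "p \<in> W" "W \<subseteq> U"
    "local_quotient m f W g h"
proof -
  have p: "p \<in> topspace (Cn m)" using assms(2,3) openin_subset by blast
  then obtain W g h where W: "p \<in> W" "local_quotient m f W g h"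
    using assms(1) unfolding meromorphic_Cn_iff_local_quotient by blast
  have "openin (Cn m) (W \<inter> U)"
    using holo_openin[OF local_quotientD(1)[OF W(2)]] assms(2) by blast
  then obtain e where e: "e > 0" "PiE {1..m} (\<lambda>i. ball (p i) e) \<subseteq> W \<inter> U"
    using openin_Cn_imp_box W(1) assms(3) by blast
  define B where "B = PiE {1..m} (\<lambda>i. ball (p i) e)"
  have B: "openin (Cn m) B" "B \<subseteq> W" "B \<subseteq> U" 
    unfolding B_def by (intro openin_Cn_box) (use e in auto)
  have "p \<in> B" using p e(1) by (auto simp: B_def)
  moreover have "local_quotient m f B g h"
    using W(2) B(2) holo_subset[OF _ B(1,2)] unfolding local_quotient_def
    by (meson subset_trans subsetD)
  ultimately show ?thesis using that[OF B_def] B(3) by blast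
qed

text \<open>A clopen argument: agreement on a dense open part spreads from \<open>S\<close> to the
  whole connected space, because after clearing denominators it is the vanishing of a holomorphic
  function on a box.\<close>

lemma meromorphic_Cn_unique:
  assumes mero: "meromorphic_Cn m F1" "meromorphic_Cn m F2"
    and S: "openin (Cn m) S" "S \<noteq> {}" "\<And>s. s \<in> S \<Longrightarrow> F1 s = F2 s"
  obtains V where "dense_open_in (Cn m) V" "\<And>s. s \<in> V \<Longrightarrow> F1 s = F2 s"
proof -
  \<comment> \<open>Agreement is asked for only on an open set that is dense in \<open>V\<close>, so
    that zeros of the denominators may be excepted.\<close>
  define ae where "ae V \<longleftrightarrow> openin (Cn m) V \<and> (\<exists>U. openin (Cn m) U \<and> (\<forall>s\<in>U. F1 s = F2 s) \<and>
    (\<forall>T. openin (Cn m) T \<and> T \<subseteq> V \<and> T \<noteq> {} \<longrightarrow> T \<inter> U \<noteq> {}))" for V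
  define E where "E = \<Union>{V. ae V}"
  have E: "openin (Cn m) E" unfolding E_def by (auto simp: ae_def)
  have "ae S" unfolding ae_def using S by blast
  then have "S \<subseteq> E" by (auto simp: E_def)
  \<comment> \<open>A neighbourhood that meets \<open>E\<close> lies in \<open>E\<close>; this
    dichotomy makes the complement of \<open>E\<close> open.\<close>
  have loc: "\<exists>W. openin (Cn m) W \<and> p \<in> W \<and> (W \<inter> E \<noteq> {} \<longrightarrow> ae W)" if p: "p \<in> topspace (Cn m)" for p
  proof -
    obtain W1 g1 h1 where W1: "p \<in> W1" "local_quotient m F1 W1 g1 h1"
      using mero(1) p unfolding meromorphic_Cn_iff_local_quotient by blast
    have W1o: "openin (Cn m) W1" using local_quotientD(1)[OF W1(2)] by (rule holo_openin)
    obtain W g2 h2 e where W: "W = PiE {1..m} (\<lambda>i. ball (p i) e)" "p \<in> W" "W \<subseteq> W1"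
      "local_quotient m F2 W g2 h2"
      using meromorphic_Cn_local_box[OF mero(2) W1o W1(1)] .
    note q1 = local_quotientD[OF W1(2)] and q2 = local_quotientD[OF W(4)]
    have W_open: "openin (Cn m) W" using q2(1) holo_openin by blast
    have g1h1: "holo m W g1" "holo m W h1" using q1(1,2) W(3) W_open holo_subset by blast+
    \<comment> \<open>The nonvanishing set of \<open>h1\<close> in \<open>V\<close> is again open
      and nonempty, so \<open>h2\<close> can be tested on it.\<close>
    have both: "\<exists>z\<in>V. h1 z \<noteq> 0 \<and> h2 z \<noteq> 0" if V: "openin (Cn m) V" "V \<subseteq> W" "V \<noteq> {}" for V
    proof -
      obtain z where "z \<in> V" "h1 z \<noteq> 0" using q1(3)[OF V(1) _ V(3)] V(2) W(3) by blast
      then have "{z \<in> V. h1 z \<noteq> 0} \<noteq> {}" by blast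
      moreover have "openin (Cn m) {z \<in> V. h1 z \<noteq> 0}"
        using holo_nonzero_open[OF g1h1(2)] V by blast
      ultimately show ?thesis using q2(3)[of "{z \<in> V. h1 z \<noteq> 0}"] V(2) by auto
    qed
    let ?f = "\<lambda>z. g1 z * h2 z - g2 z * h1 z"
    have f: "holo m W ?f" using g1h1 q2 by (intro holo_diff holo_mult)
    have "ae W" if ne: "W \<inter> E \<noteq> {}"
    proof -
      obtain V U where V: "openin (Cn m) V" "W \<inter> V \<noteq> {}" and U: "openin (Cn m) U"
        "\<forall>s\<in>U. F1 s = F2 s" "\<forall>T. openin (Cn m) T \<and> T \<subseteq> V \<and> T \<noteq> {} \<longrightarrow> T \<inter> U \<noteq> {}"
        using ne unfolding E_def ae_def by blast
      have WV: "openin (Cn m) (W \<inter> V)" using W_open V by blast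
      have "?f z = 0" if "z \<in> W \<inter> V" for z
      proof (rule holo_continuous_zero_dense[OF _ _ that])
        show "holo m (W \<inter> V) ?f" using holo_subset[OF f WV] by blast
        fix T assume T: "openin (Cn m) T" "T \<noteq> {}" "T \<subseteq> W \<inter> V"
        then have "T \<inter> U \<noteq> {}" using U(3) by blast
        then obtain z where z: "z \<in> T \<inter> U" "h1 z \<noteq> 0" "h2 z \<noteq> 0"
          using both[of "T \<inter> U"] T U(1) by blast
        then have "z \<in> W" "z \<in> W1" "F1 z = F2 z" using T(3) W(3) U(2) by auto
        then have "g1 z / h1 z = g2 z / h2 z"
          using q1(4)[of z] q2(4)[of z] z by simp
        then have "?f z = 0" using z by (simp add: field_simps)
        then show "\<exists>z\<in>T. ?f z = 0" using z by blast
      qed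
      then have f0: "?f z = 0" if "z \<in> W" for z
        using holo_box_identity[OF f W(1) WV _ V(2) _ that] by blast
      define U' where "U' = {z \<in> {z \<in> W. h1 z \<noteq> 0}. h2 z \<noteq> 0}"
      have U': "openin (Cn m) U'" unfolding U'_def
        by (intro holo_nonzero_open[OF q2(2)] holo_nonzero_open[OF g1h1(2)] W_open) auto
      have "F1 s = F2 s" if "s \<in> U'" for s
      proof -
        have s: "s \<in> W" "h1 s \<noteq> 0" "h2 s \<noteq> 0" using that by (auto simp: U'_def)
        then have "F1 s = g1 s / h1 s" "F2 s = g2 s / h2 s" using q1(4) q2(4) W(3) by auto
        then show ?thesis using f0[OF s(1)] s by (simp add: frac_eq_eq)
      qed
      moreover have "T \<inter> U' \<noteq> {}" if "openin (Cn m) T" "T \<subseteq> W" "T \<noteq> {}" for T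
        using both[OF that] that(2) unfolding U'_def by blast
      ultimately show "ae W" unfolding ae_def using W_open U' by blast
    qed
    then show ?thesis using W_open W(2) by blast
  qed
  have "closedin (Cn m) E"
    unfolding closedin_def
  proof
    show "E \<subseteq> topspace (Cn m)" using E openin_subset by blast
    show "openin (Cn m) (topspace (Cn m) - E)"
    proof (subst openin_subopen, intro ballI)
      fix p assume p: "p \<in> topspace (Cn m) - E"
      then obtain W where W: "openin (Cn m) W" "p \<in> W" "W \<inter> E \<noteq> {} \<longrightarrow> ae W" using loc by blast
      then have "W \<inter> E = {}" using p unfolding E_def by blast
      then show "\<exists>T. openin (Cn m) T \<and> p \<in> T \<and> T \<subseteq> topspace (Cn m) - E"
        using W openin_subset by blast
    qed
  qed
  then have E_all: "E = topspace (Cn m)"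
    using connected_space_Cn[of m] E \<open>S \<subseteq> E\<close> S(2) unfolding connected_space_clopen_in by blast
  \<comment> \<open>This is the largest open set of agreement; it is dense because \<open>E\<close>
    is the whole space.\<close>
  define V where "V = \<Union>{U. openin (Cn m) U \<and> (\<forall>s\<in>U. F1 s = F2 s)}"
  have "dense_open_in (Cn m) V"
    unfolding dense_open_in_iff
  proof (intro conjI allI impI)
    show "openin (Cn m) V" unfolding V_def by blast
    fix T assume T: "openin (Cn m) T \<and> T \<noteq> {}"
    then obtain p where "p \<in> T" "p \<in> E" using E_all openin_subset by blast
    then obtain Y where Y: "ae Y" "p \<in> Y" by (auto simp: E_def)
    then obtain U where U: "openin (Cn m) U" "\<forall>s\<in>U. F1 s = F2 s"
      "\<forall>T. openin (Cn m) T \<and> T \<subseteq> Y \<and> T \<noteq> {} \<longrightarrow> T \<inter> U \<noteq> {}" and "openin (Cn m) Y"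
      unfolding ae_def by blast
    then have "T \<inter> Y \<inter> U \<noteq> {}" using T \<open>p \<in> T\<close> Y(2) by blast
    then show "\<exists>z\<in>T. z \<in> V" using U unfolding V_def by blast
  qed
  then show ?thesis using that unfolding V_def by blast
qed

text \<open>The existence of \<open>F\<close> makes the choice operator return a genuine
  continuation, which uniqueness then compares with \<open>F\<close>.\<close>

lemma meromorphic_continuation_ae:
  assumes F: "meromorphic_Cn m F" "\<And>s. s \<in> S \<Longrightarrow> F s = f s"
    and S: "openin (Cn m) S" "S \<noteq> {}"
  obtains V where "dense_open_in (Cn m) V" "\<And>s. s \<in> V \<Longrightarrow> meromorphic_continuation m S f s = F s"
proof -
  let ?G = "meromorphic_continuation m S f"
  have "meromorphic_Cn m ?G \<and> (\<forall>s\<in>S. ?G s = f s)"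
    unfolding meromorphic_continuation_def by (rule someI[of _ F]) (use F in auto)
  then show ?thesis using meromorphic_Cn_unique[of m ?G F S] F S that by metis
qed

text \<open>The values of \<open>G\<close> on the zero set of \<open>l\<close> are left free, which
  admits products whose removable singularities have been filled in.\<close>

lemma meromorphic_Cn_holo_mult_ae:
  assumes F: "meromorphic_Cn m F" and l: "holo m (topspace (Cn m)) l"
    and dense: "\<And>V. openin (Cn m) V \<Longrightarrow> V \<noteq> {} \<Longrightarrow> \<exists>z\<in>V. l z \<noteq> 0"
    and G: "\<And>z. z \<in> topspace (Cn m) \<Longrightarrow> l z \<noteq> 0 \<Longrightarrow> G z = l z * F z"
  shows "meromorphic_Cn m G"
  unfolding meromorphic_Cn_iff_local_quotient
proof
  fix p assume "p \<in> topspace (Cn m)"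
  then obtain W g h where W: "p \<in> W" "local_quotient m F W g h"
    using F unfolding meromorphic_Cn_iff_local_quotient by blast
  note q = local_quotientD[OF W(2)]
  have sub: "W \<subseteq> topspace (Cn m)" using holo_openin[OF q(1)] openin_subset by blast
  have lW: "holo m W l" using holo_subset[OF l holo_openin[OF q(1)] sub] .
  have "\<exists>z\<in>V. h z * l z \<noteq> 0" if V: "openin (Cn m) V" "V \<subseteq> W" "V \<noteq> {}" for V
  proof -
    have "openin (Cn m) {z \<in> V. h z \<noteq> 0}" using holo_nonzero_open[OF q(2)] V by blast
    moreover have "{z \<in> V. h z \<noteq> 0} \<noteq> {}" using q(3) V by blast
    ultimately show ?thesis using dense[of "{z \<in> V. h z \<noteq> 0}"] by auto
  qed
  moreover have "G z = (g z * l z * l z) / (h z * l z)" if "z \<in> W" "h z * l z \<noteq> 0" for z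
    using that G[of z] q(4)[of z] sub by auto
  \<comment> \<open>An additional \<open>l\<close> above and below makes the denominator vanish on
    the zeros of \<open>l\<close>, where nothing is known about \<open>G\<close>.\<close>
  ultimately have "local_quotient m G W (\<lambda>z. g z * l z * l z) (\<lambda>z. h z * l z)"
    unfolding local_quotient_def using holo_mult[OF holo_mult[OF q(1) lW] lW] holo_mult[OF q(2) lW]
    by blast
  then show "\<exists>W g h. p \<in> W \<and> local_quotient m G W g h" using W(1) by blast
qed

section \<open>Summability of products over tuples and of binomial coefficients\<close>

lemma summable_on_prod_PiE:
  fixes f :: "'a \<Rightarrow> 'b \<Rightarrow> real"
  assumes "finite I" "\<And>i k. i \<in> I \<Longrightarrow> k \<in> B i \<Longrightarrow> f i k \<ge> 0" "\<And>i. i \<in> I \<Longrightarrow> f i summable_on B i"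
  shows "(\<lambda>k. \<Prod>i\<in>I. f i (k i)) summable_on PiE I B"
proof (rule nonneg_bdd_above_summable_on)
  show "(\<Prod>i\<in>I. f i (k i)) \<ge> 0" if "k \<in> PiE I B" for k
    using assms(2) that by (intro prod_nonneg) auto
  show "bdd_above (sum (\<lambda>k. \<Prod>i\<in>I. f i (k i)) ` {F. F \<subseteq> PiE I B \<and> finite F})"
  proof (rule bdd_aboveI2)
    fix F assume "F \<in> {F. F \<subseteq> PiE I B \<and> finite F}"
    then have F: "F \<subseteq> PiE I B" "finite F" by auto
    \<comment> \<open>Finitely many tuples lie in the product of their finite coordinate
      projections; the sum over that product factors.\<close>
    define B' where "B' i = (\<lambda>k. k i) ` F" for i
    have B': "finite (B' i)" "i \<in> I \<Longrightarrow> B' i \<subseteq> B i" for i using F by (auto simp: B'_def)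
    have "F \<subseteq> PiE I B'" using F by (auto simp: B'_def)
    then have "(\<Sum>k\<in>F. \<Prod>i\<in>I. f i (k i)) \<le> (\<Sum>k\<in>PiE I B'. \<Prod>i\<in>I. f i (k i))"
      using B' assms by (intro sum_mono2 finite_PiE prod_nonneg) (auto simp: PiE_iff subset_iff)
    also have "\<dots> = (\<Prod>i\<in>I. \<Sum>k\<in>B' i. f i k)"
      using B' assms(1) by (intro prod_sum_PiE[symmetric]) auto
    also have "\<dots> \<le> (\<Prod>i\<in>I. infsum (f i) (B i))"
      using B' assms by (intro prod_mono conjI sum_nonneg finite_sum_le_infsum) (auto simp: subset_iff)
    finally show "(\<Sum>k\<in>F. \<Prod>i\<in>I. f i (k i)) \<le> (\<Prod>i\<in>I. infsum (f i) (B i))" .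
  qed
qed

text \<open>The rising factorial absorbs the sign, and its modulus is bounded by the same expression
  at a real bound of \<open>norm s\<close>.\<close>

lemma gbinomial_minus_pochhammer:
  fixes s :: "'a :: field_char_0"
  shows "((- s) gchoose k) * (-1) ^ k = pochhammer s k / fact k"
proof -
  have "((- s) gchoose k) * (-1) ^ k = ((-1)^k * (-1)^k) * (pochhammer s k / fact k)"
    by (simp add: gbinomial_pochhammer)
  then show ?thesis by (simp flip: power_mult_distrib)
qed

lemma norm_pochhammer_le:
  fixes s :: complex
  assumes "norm s \<le> B"
  shows "norm (pochhammer s k) \<le> pochhammer B k"
  unfolding pochhammer_prod prod_norm[symmetric]
proof (rule prod_mono, intro conjI)
  fix i
  have "norm (s + of_nat i) \<le> norm s + of_nat i" using norm_triangle_ineq[of s "of_nat i"] by simp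
  then show "norm (s + of_nat i) \<le> B + of_nat i" using assms by simp
qed auto

lemma pochhammer_real_nonneg: "0 \<le> B \<Longrightarrow> 0 \<le> pochhammer (B :: real) k"
  unfolding pochhammer_prod by (intro prod_nonneg) auto

text \<open>The terms are nonnegative and form the binomial series of
  \<open>(1 - y) powr (-B)\<close>.\<close>

lemma summable_pochhammer_power:
  fixes B y :: real
  assumes "0 \<le> B" "0 \<le> y" "y < 1"
  shows "(\<lambda>k. pochhammer B k / fact k * y ^ k) summable_on UNIV"
proof -
  have "(\<lambda>k. ((-B) gchoose k) * (- y) ^ k) sums (1 + (- y)) powr (- B)"
    using assms by (intro gen_binomial_real) auto
  also have "(\<lambda>k. ((-B) gchoose k) * (- y) ^ k) = (\<lambda>k. pochhammer B k / fact k * y ^ k)"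
    by (intro ext) (simp add: gbinomial_minus_pochhammer[symmetric] power_minus[of y])
  finally show ?thesis
    using assms by (subst summable_on_UNIV_nonneg_real_iff) (auto simp: sums_iff intro!: divide_nonneg_nonneg mult_nonneg_nonneg pochhammer_real_nonneg)
qed

subsection \<open>Locally dominated families of one-variable functions\<close>

text \<open>One radius and one constant serve all \<open>K\<close>; the geometric decay in
  \<open>K\<close> outweighs the growth of the binomial coefficients.\<close>

definition dominated_at :: "real \<Rightarrow> (nat \<Rightarrow> complex \<Rightarrow> complex) \<Rightarrow> complex \<Rightarrow> bool" where
  "dominated_at \<rho> \<phi> w0 \<longleftrightarrow> (\<exists>\<delta>>0. \<exists>C\<ge>0. \<forall>K. \<phi> K holomorphic_on ball w0 \<delta> \<and>
     (\<forall>w\<in>ball w0 \<delta>. norm (\<phi> K w) \<le> C * \<bar>\<rho>\<bar> ^ K))"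

text \<open>Uniformity matters only for large \<open>K\<close>. The finitely many other functions
  are absorbed one at a time by shrinking the disc and enlarging the constant.\<close>

lemma dominated_atI:
  assumes \<rho>: "\<rho> \<noteq> 0" and an: "\<And>K. \<phi> K analytic_on {w0}"
    and tail: "\<delta> > 0" "C \<ge> 0" "\<And>K. K \<ge> K0 \<Longrightarrow> \<phi> K holomorphic_on ball w0 \<delta>"
      "\<And>K w. K \<ge> K0 \<Longrightarrow> w \<in> ball w0 \<delta> \<Longrightarrow> norm (\<phi> K w) \<le> C * \<bar>\<rho>\<bar> ^ K"
  shows "dominated_at \<rho> \<phi> w0"
proof -
  have "\<exists>\<delta>>0. \<exists>C\<ge>0. \<forall>K. (K < n \<or> K \<ge> K0) \<longrightarrow> \<phi> K holomorphic_on ball w0 \<delta> \<and>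
     (\<forall>w\<in>ball w0 \<delta>. norm (\<phi> K w) \<le> C * \<bar>\<rho>\<bar> ^ K)" for n
  proof (induction n)
    case 0
    show ?case using tail by (intro exI[of _ \<delta>] conjI exI[of _ C]) auto
  next
    case (Suc n)
    then obtain d M where d: "d > 0" "M \<ge> 0" and dM: "\<And>K. K < n \<or> K \<ge> K0 \<Longrightarrow> \<phi> K holomorphic_on ball w0 d"
      "\<And>K w. K < n \<or> K \<ge> K0 \<Longrightarrow> w\<in>ball w0 d \<Longrightarrow> norm (\<phi> K w) \<le> M * \<bar>\<rho>\<bar> ^ K" by blast
    obtain e where e: "e > 0" "\<phi> n holomorphic_on ball w0 e"
      using an[of n] by (auto simp: analytic_on_def)
    have "continuous_on (cball w0 (e/2)) (\<phi> n)"
      using e by (intro holomorphic_on_imp_continuous_on holomorphic_on_subset[OF e(2)]) auto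
    then have "bounded (\<phi> n ` cball w0 (e/2))"
      by (intro compact_imp_bounded compact_continuous_image) auto
    then obtain L where L: "\<And>w. w \<in> cball w0 (e/2) \<Longrightarrow> norm (\<phi> n w) \<le> L"
      unfolding bounded_iff by (metis image_eqI)
    have "L \<ge> 0" using L[of w0] e(1) by (auto intro: order_trans[OF norm_ge_zero])
    define d' where "d' = min d (e/2)"
    \<comment> \<open>The bound \<open>L\<close> for the single function \<open>\<phi> n\<close> is
      rescaled to the required shape, using \<open>\<rho> \<noteq> 0\<close>.\<close>
    define M' where "M' = max M (L / \<bar>\<rho>\<bar> ^ n)"
    have "\<phi> K holomorphic_on ball w0 d' \<and> (\<forall>w\<in>ball w0 d'. norm (\<phi> K w) \<le> M' * \<bar>\<rho>\<bar> ^ K)"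
      if "K < Suc n \<or> K \<ge> K0" for K
    proof (cases "K < n \<or> K \<ge> K0")
      case True
      have "M * \<bar>\<rho>\<bar> ^ K \<le> M' * \<bar>\<rho>\<bar> ^ K" by (intro mult_right_mono) (auto simp: M'_def)
      moreover have "ball w0 d' \<subseteq> ball w0 d" by (auto simp: d'_def)
      ultimately show ?thesis using dM[OF True] by (meson holomorphic_on_subset order_trans subsetD)
    next
      case False
      with that have [simp]: "K = n" by auto
      have "L = L / \<bar>\<rho>\<bar> ^ n * \<bar>\<rho>\<bar> ^ n" using \<rho> by simp
      also have "\<dots> \<le> M' * \<bar>\<rho>\<bar> ^ n" by (intro mult_right_mono) (auto simp: M'_def)
      finally have "L \<le> M' * \<bar>\<rho>\<bar> ^ n" .
      moreover have "norm (\<phi> n w) \<le> L" if "w \<in> ball w0 d'" for w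
        using that e(1) by (intro L) (auto simp: d'_def)
      moreover have "ball w0 d' \<subseteq> ball w0 e" using e(1) by (auto simp: d'_def)
      ultimately show ?thesis
        using holomorphic_on_subset[OF e(2)] by fastforce
    qed
    moreover have "d' > 0" "M' \<ge> 0" using d e by (auto simp: d'_def M'_def)
    ultimately show ?case by blast
  qed
  from this[of K0] obtain d M where "d > 0" "M \<ge> 0" 
      "\<forall>K. (K < K0 \<or> K \<ge> K0) \<longrightarrow> \<phi> K holomorphic_on ball w0 d \<and> (\<forall>w\<in>ball w0 d. norm (\<phi> K w) \<le> M * \<bar>\<rho>\<bar> ^ K)"
    by blast
  then show ?thesis unfolding dominated_at_def using linorder_not_less by blast
qed

text \<open>The tuple \<open>k\<close> collects the exponents of the binomial expansions of the \<open>U\<^sub>n\<close>; the sums over the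
  \<open>n\<^sub>t\<close> have been carried out and give the factors \<open>\<phi>\<^sub>t\<close>.\<close>

definition binomial_term ::
  "nat \<Rightarrow> (nat \<Rightarrow> nat \<Rightarrow> complex \<Rightarrow> complex) \<Rightarrow> (nat \<Rightarrow> complex) \<Rightarrow> (nat \<Rightarrow> nat) \<Rightarrow> complex" where
  "binomial_term e \<phi> s k = (\<Prod>t=1..e. pochhammer (s t) (k t) / fact (k t)) *
     (\<Prod>t=1..e. \<phi> t (\<Sum>i=t..e. k i) (\<Sum>i=t..e. s i))"

definition binomial_series ::
  "nat \<Rightarrow> (nat \<Rightarrow> nat \<Rightarrow> complex \<Rightarrow> complex) \<Rightarrow> (nat \<Rightarrow> complex) \<Rightarrow> complex" where
  "binomial_series e \<phi> s = (\<Sum>\<^sub>\<infinity>k\<in>{1..e} \<rightarrow>\<^sub>E UNIV. binomial_term e \<phi> s k)"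

text \<open>A tail sum of \<open>k\<close> is at least its first entry, so the decay of the
  \<open>t\<close>-th factor may be weakened to exponent \<open>k t\<close>; the bound then factors
  over \<open>t\<close>.\<close>

lemma norm_binomial_term_le:
  assumes \<rho>: "\<bar>\<rho>\<bar> < 1" 
    and \<phi>: "\<And>t. t \<in> {1..e} \<Longrightarrow> norm (\<phi> t (\<Sum>i=t..e. k i) (\<Sum>i=t..e. s i)) \<le> C t * \<bar>\<rho>\<bar> ^ (\<Sum>i=t..e. k i)"
    and C: "\<And>t. t \<in> {1..e} \<Longrightarrow> C t \<ge> 0"
    and s: "\<And>t. t \<in> {1..e} \<Longrightarrow> norm (s t) \<le> B t"
  shows "norm (binomial_term e \<phi> s k)
    \<le> (\<Prod>t=1..e. C t) * (\<Prod>t=1..e. pochhammer (B t) (k t) / fact (k t) * \<bar>\<rho>\<bar> ^ k t)"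
proof -
  have "norm (\<phi> t (\<Sum>i=t..e. k i) (\<Sum>i=t..e. s i)) \<le> C t * \<bar>\<rho>\<bar> ^ k t" if t: "t \<in> {1..e}" for t
  proof -
    have "k t \<le> (\<Sum>i=t..e. k i)" using t by (intro member_le_sum) auto
    then have "\<bar>\<rho>\<bar> ^ (\<Sum>i=t..e. k i) \<le> \<bar>\<rho>\<bar> ^ k t" using \<rho> by (intro power_decreasing) auto
    then show ?thesis using \<phi>[OF t] C[OF t] by (meson mult_left_mono order_trans)
  qed
  moreover have "norm (pochhammer (s t) (k t) / fact (k t)) \<le> pochhammer (B t) (k t) / fact (k t)"
    if t: "t \<in> {1..e}" for t
    using norm_pochhammer_le[OF s[OF t]] by (simp add: norm_divide divide_right_mono)
  ultimately have "norm (binomial_term e \<phi> s k) \<le> (\<Prod>t=1..e. pochhammer (B t) (k t) / fact (k t)) *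
    (\<Prod>t=1..e. C t * \<bar>\<rho>\<bar> ^ k t)"
    unfolding binomial_term_def norm_mult prod_norm[symmetric]
    by (intro mult_mono prod_mono prod_nonneg conjI norm_ge_zero) (auto intro: order_trans[OF norm_ge_zero])
  also have "\<dots> = (\<Prod>t=1..e. C t) * (\<Prod>t=1..e. pochhammer (B t) (k t) / fact (k t) * \<bar>\<rho>\<bar> ^ k t)"
    by (simp add: prod.distrib[symmetric] mult_ac)
  finally show ?thesis .
qed

lemma summable_pochhammer_PiE:
  fixes \<rho> C :: real and e :: nat
  assumes "\<bar>\<rho>\<bar> < 1" "\<And>t. t \<in> {1..e} \<Longrightarrow> 0 \<le> B t"
  shows "(\<lambda>k. C * (\<Prod>t=1..e. pochhammer (B t) (k t) / fact (k t) * \<bar>\<rho>\<bar> ^ k t))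
     summable_on ({1..e} \<rightarrow>\<^sub>E UNIV)" 
  by (intro summable_on_cmult_right summable_on_prod_PiE summable_pochhammer_power)
     (use assms in \<open>auto intro!: mult_nonneg_nonneg divide_nonneg_nonneg pochhammer_real_nonneg\<close>)

lemma summable_binomial_term:
  assumes \<rho>: "\<bar>\<rho>\<bar> < 1"
    and \<phi>: "\<And>t. t \<in> {1..e} \<Longrightarrow> \<exists>C\<ge>0. \<forall>K. norm (\<phi> t K (\<Sum>i=t..e. s i)) \<le> C * \<bar>\<rho>\<bar> ^ K"
  shows "binomial_term e \<phi> s summable_on ({1..e} \<rightarrow>\<^sub>E UNIV)"
proof -
  obtain C where C: "\<And>t. t \<in> {1..e} \<Longrightarrow> C t \<ge> 0"
    "\<And>t K. t \<in> {1..e} \<Longrightarrow> norm (\<phi> t K (\<Sum>i=t..e. s i)) \<le> C t * \<bar>\<rho>\<bar> ^ K"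
    using \<phi> by metis
  have "(\<lambda>k. norm (binomial_term e \<phi> s k)) summable_on ({1..e} \<rightarrow>\<^sub>E UNIV)"
    by (rule summable_on_comparison_test[OF summable_pochhammer_PiE[OF \<rho>]
          norm_binomial_term_le[where \<phi> = \<phi> and B = "\<lambda>t. norm (s t)" and C = C, OF \<rho>]])
       (use C in auto)
  then show ?thesis by (rule abs_summable_summable)
qed

text \<open>Near \<open>p\<close> all coordinates and all tail sums stay in fixed discs, so one
  summable majorant serves a whole neighbourhood.\<close>

lemma holo_binomial_series:
  assumes \<rho>: "\<bar>\<rho>\<bar> < 1" and p: "p \<in> topspace (Cn e)"
    and \<phi>: "\<And>t. t \<in> {1..e} \<Longrightarrow> dominated_at \<rho> (\<phi> t) (\<Sum>i=t..e. p i)"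
  obtains W where "p \<in> W" "holo e W (binomial_series e \<phi>)"
proof -
  obtain \<delta> C where \<delta>: "\<And>t. t \<in> {1..e} \<Longrightarrow> \<delta> t > 0" and C: "\<And>t. t \<in> {1..e} \<Longrightarrow> C t \<ge> 0"
    and hol: "\<And>t K. t \<in> {1..e} \<Longrightarrow> \<phi> t K holomorphic_on ball (\<Sum>i=t..e. p i) (\<delta> t)"
    and bd: "\<And>t K w. t \<in> {1..e} \<Longrightarrow> w \<in> ball (\<Sum>i=t..e. p i) (\<delta> t) \<Longrightarrow> norm (\<phi> t K w) \<le> C t * \<bar>\<rho>\<bar> ^ K"
    using \<phi> unfolding dominated_at_def by metis
  \<comment> \<open>The first condition bounds the binomial coefficients, the second keeps the tail
    sums where the family is dominated.\<close>
  define V where "V t = {s \<in> topspace (Cn e). s t \<in> ball (p t) 1} \<inter> 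
    {s \<in> topspace (Cn e). (\<Sum>i=t..e. s i) \<in> ball (\<Sum>i=t..e. p i) (\<delta> t)}" for t
  define W where "W = topspace (Cn e) \<inter> (\<Inter>t\<in>{1..e}. V t)"
  have V: "openin (Cn e) (V t)" if t: "t \<in> {1..e}" for t
    unfolding V_def
  proof (intro openin_Int)
    show "openin (Cn e) {s \<in> topspace (Cn e). s t \<in> ball (p t) 1}"
      by (rule openin_continuous_map_preimage[OF continuous_map_Cn_coord[OF t]]) auto
    show "openin (Cn e) {s \<in> topspace (Cn e). (\<Sum>i=t..e. s i) \<in> ball (\<Sum>i=t..e. p i) (\<delta> t)}"
      by (rule openin_continuous_map_preimage[where Y = euclidean])
         (use t in \<open>auto intro!: continuous_map_sum continuous_map_Cn_coord\<close>)
  qed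
  have W: "openin (Cn e) W"
    using openin_INT[of "{1..e}" "Cn e" V] V unfolding W_def by (simp add: Int_commute)
  have pW: "p \<in> W" using p \<delta> by (auto simp: W_def V_def)
  have "holo e W (\<lambda>s. \<Sum>\<^sub>\<infinity>k\<in>{1..e} \<rightarrow>\<^sub>E UNIV. binomial_term e \<phi> s k)"
  proof (rule holo_infsum[OF W])
    fix k :: "nat \<Rightarrow> nat"
    have sum: "holo e W (\<lambda>s. \<Sum>i=t..e. s i)" if "t \<in> {1..e}" for t
      using that W by (intro holo_sum holo_coord) auto
    have "holo e W (\<lambda>s. pochhammer (s t) (k t) / fact (k t))" if "t \<in> {1..e}" for t
      by (rule holo_compose[OF holo_coord[OF W that], of _ UNIV])
         (auto simp: pochhammer_prod intro!: holomorphic_intros)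
    moreover have "holo e W (\<lambda>s. \<phi> t (\<Sum>i=t..e. k i) (\<Sum>i=t..e. s i))" if "t \<in> {1..e}" for t
      using that by (intro holo_compose[OF sum hol]) (auto simp: W_def V_def)
    ultimately show "holo e W (\<lambda>s. binomial_term e \<phi> s k)"
      unfolding binomial_term_def by (intro holo_mult holo_prod W) auto
  next
    fix k s assume s: "s \<in> W"
    show "norm (binomial_term e \<phi> s k) \<le> (\<Prod>t=1..e. C t) * 
      (\<Prod>t=1..e. pochhammer (norm (p t) + 1) (k t) / fact (k t) * \<bar>\<rho>\<bar> ^ k t)"
    proof (rule norm_binomial_term_le[OF \<rho>])
      fix t assume t: "t \<in> {1..e}"
      show "norm (\<phi> t (\<Sum>i=t..e. k i) (\<Sum>i=t..e. s i)) \<le> C t * \<bar>\<rho>\<bar> ^ (\<Sum>i=t..e. k i)"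
        using s t by (intro bd) (auto simp: W_def V_def)
      have "dist (p t) (s t) < 1" using s t by (auto simp: W_def V_def)
      moreover have "norm (s t) \<le> norm (p t) + norm (s t - p t)" by (metis norm_triangle_sub)
      ultimately show "norm (s t) \<le> norm (p t) + 1" by (simp add: dist_norm norm_minus_commute)
    qed (use C in auto)
  next
    show "(\<lambda>k. (\<Prod>t=1..e. C t) * (\<Prod>t=1..e. pochhammer (norm (p t) + 1) (k t) / fact (k t) * \<bar>\<rho>\<bar> ^ k t))
     summable_on ({1..e} \<rightarrow>\<^sub>E UNIV)" 
      by (rule summable_pochhammer_PiE[OF \<rho>]) (auto intro: add_nonneg_nonneg)
  qed
  then show ?thesis using that[OF pW] unfolding binomial_series_def by simp
qed

text \<open>\<open>T\<close> prescribes the motion of the tail sums along a line: the one of index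
  \<open>t\<close> moves by \<open>l * T t\<close>. It is fixed where \<open>T t = 0\<close> and
  otherwise meets a countable set for only countably many \<open>l\<close>.\<close>

lemma perturb_tail_sums:
  fixes P :: "nat \<Rightarrow> complex set" and T :: "nat \<Rightarrow> complex"
  assumes V: "openin (Cn m) V" "s \<in> V" and P: "\<And>t. t \<in> {1..m} \<Longrightarrow> countable (P t)" and T: "T (Suc m) = 0"
  obtains s' where "s' \<in> V" 
    "\<And>t. t \<in> {1..m} \<Longrightarrow> T t = 0 \<Longrightarrow> (\<Sum>i=t..m. s' i) = (\<Sum>i=t..m. s i)"
    "\<And>t. t \<in> {1..m} \<Longrightarrow> T t \<noteq> 0 \<Longrightarrow> (\<Sum>i=t..m. s' i) \<notin> P t"
proof -
  have s: "s \<in> topspace (Cn m)" using V openin_subset by blast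
  \<comment> \<open>The tail sums of the differences of \<open>T\<close> telescope, and
    \<open>T (Suc m) = 0\<close> closes the telescope.\<close>
  define c where "c l = (\<lambda>i\<in>{1..m}. s i + of_real l * (T i - T (Suc i)))" for l :: real
  have cont: "continuous_map euclidean (Cn m) c"
    unfolding c_def by (rule continuous_map_into_Cn) (auto intro!: continuous_intros)
  have "c 0 = s" using s by (auto simp: c_def PiE_def extensional_def fun_eq_iff)
  moreover have "open {l. c l \<in> V}"
    using openin_continuous_map_preimage[OF cont V(1)] by simp
  ultimately obtain \<delta> where \<delta>: "\<delta> > 0" "ball 0 \<delta> \<subseteq> {l. c l \<in> V}"
    using V(2) by (metis (mono_tags, lifting) mem_Collect_eq openE)
  have tail: "(\<Sum>i=t..m. c l i) = (\<Sum>i=t..m. s i) + of_real l * T t" if "t \<in> {1..m}" for t l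
  proof -
    have "(\<Sum>i=t..m. c l i) = (\<Sum>i=t..m. s i + of_real l * (T i - T (Suc i)))"
      using that by (intro sum.cong) (auto simp: c_def)
    also have "\<dots> = (\<Sum>i=t..m. s i) - of_real l * (\<Sum>i=t..m. T (Suc i) - T i)"
      by (simp add: sum.distrib sum_distrib_left sum_subtractf[symmetric] sum_negf[symmetric] algebra_simps)
    also have "(\<Sum>i=t..m. T (Suc i) - T i) = T (Suc m) - T t"
      using that by (intro sum_Suc_diff) auto
    finally show ?thesis using T by simp
  qed
  define bad where "bad = (\<Union>t\<in>{t\<in>{1..m}. T t \<noteq> 0}. {l. (\<Sum>i=t..m. s i) + of_real l * T t \<in> P t})"
  have "countable bad"
    unfolding bad_def
  proof (intro countable_UN)
    fix t assume t: "t \<in> {t\<in>{1..m}. T t \<noteq> 0}"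
    have "inj_on (\<lambda>l::real. (\<Sum>i=t..m. s i) + of_real l * T t) {l. (\<Sum>i=t..m. s i) + of_real l * T t \<in> P t}"
      using t by (auto simp: inj_on_def)
    moreover have "countable ((\<lambda>l::real. (\<Sum>i=t..m. s i) + of_real l * T t) ` {l. (\<Sum>i=t..m. s i) + of_real l * T t \<in> P t})"
      using P[of t] t by (rule_tac countable_subset[of _ "P t"]) auto
    ultimately show "countable {l. (\<Sum>i=t..m. s i) + of_real l * T t \<in> P t}"
      by (metis countable_image_inj_on)
  qed auto
  \<comment> \<open>A ball of real parameters is uncountable, so some small \<open>l\<close> avoids
    every bad value.\<close>
  then have "\<not> ball 0 \<delta> \<subseteq> bad" using uncountable_ball[OF \<delta>(1)] countable_subset by blast
  then obtain l where l: "l \<in> ball 0 \<delta>" "l \<notin> bad" by blast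
  show ?thesis
  proof (rule that[of "c l"])
    show "c l \<in> V" using l \<delta> by blast
  qed (use l(2) tail in \<open>auto simp: bad_def\<close>)
qed

section \<open>Geometric factors, their poles and their domination\<close>

locale lucas_factors =
  fixes \<alpha> \<rho> D :: real and q :: nat
  assumes \<alpha>: "\<alpha> > 1" and \<rho>: "\<rho> \<noteq> 0" "\<bar>\<rho>\<bar> < 1" and D: "D > 0" and q: "q \<ge> 1"
begin

lemma ln_\<alpha>: "ln \<alpha> > 0"
  using \<alpha> by simp

text \<open>This is \<open>\<rho> ^ K\<close> times \<alpha> to the power \<open>-w\<close>, the
  ratio of the geometric progressions that arise from summing over the increments of the
  indices.\<close>

definition X :: "nat \<Rightarrow> complex \<Rightarrow> complex" where
  "X K w = of_real \<rho> ^ K * exp (- (w * of_real (ln \<alpha>)))"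

text \<open>The sum of \<open>X K w ^ (q * n + r)\<close> over \<open>n\<close> where it converges,
  kept as a formula for all \<open>w\<close>.\<close>

definition geo :: "nat \<Rightarrow> nat \<Rightarrow> complex \<Rightarrow> complex" where
  "geo r K w = X K w ^ r / (1 - X K w ^ q)"

text \<open>The holomorphic extension of \<open>(w - w0) * geo r K w\<close> across \<open>w0\<close>.\<close>

definition geo_res :: "complex \<Rightarrow> nat \<Rightarrow> nat \<Rightarrow> complex \<Rightarrow> complex" where
  "geo_res w0 r K w = (if w = w0 then if X K w0 ^ q = 1 then X K w0 ^ r / (of_nat q * of_real (ln \<alpha>)) else 0
     else (w - w0) * geo r K w)"

lemma norm_X: "norm (X K w) = \<bar>\<rho>\<bar> ^ K * exp (- (Re w * ln \<alpha>))"
  by (simp add: X_def norm_mult norm_power)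

lemma holomorphic_X [holomorphic_intros]: "X K holomorphic_on S"
  unfolding X_def[abs_def] by (intro holomorphic_intros)

lemma analytic_X: "X K analytic_on S"
  using holomorphic_X[of K UNIV] analytic_on_holomorphic by blast

text \<open>At such a point \<open>X\<close> has modulus one, and the strictly decreasing powers of
  \<open>\<bar>\<rho>\<bar>\<close> then determine the index.\<close>

lemma X_power_eq_1_unique:
  assumes "X K w ^ q = 1" "X K' w ^ q = 1"
  shows "K = K'"
proof -
  have "norm (X K w) = 1" "norm (X K' w) = 1"
    using assms q by (metis norm_one norm_power power_eq_1_iff norm_ge_zero not_one_le_zero)+
  then have "\<bar>\<rho>\<bar> ^ K * exp (- (Re w * ln \<alpha>)) = \<bar>\<rho>\<bar> ^ K' * exp (- (Re w * ln \<alpha>))"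
    by (simp only: norm_X)
  then have "\<bar>\<rho>\<bar> ^ K = \<bar>\<rho>\<bar> ^ K'" by simp
  then show ?thesis using \<rho> by (metis less_irrefl linorder_neqE_nat power_strict_decreasing zero_less_abs_iff)
qed

text \<open>For each \<open>K\<close> these are the zeros of an entire function, nonconstant because
  the moduli of \<open>X K\<close> at \<open>0\<close> and \<open>-1\<close> differ.\<close>

lemma countable_poles: "countable {w. \<exists>K. X K w ^ q = 1}"
proof -
  have "countable {w\<in>UNIV. X K w ^ q - 1 = 0}" for K
  proof (rule holomorphic_countable_zeros)
    show "(\<lambda>w. X K w ^ q - 1) holomorphic_on UNIV" by (intro holomorphic_intros)
    show "\<not> (\<lambda>w. X K w ^ q - 1) constant_on UNIV"
    proof
      assume "(\<lambda>w. X K w ^ q - 1) constant_on UNIV"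
      then obtain c where "\<And>w. X K w ^ q - 1 = c" unfolding constant_on_def by auto
      then have "X K 0 ^ q - 1 = X K (-1) ^ q - 1" by simp
      then have "norm (X K 0 ^ q) = norm (X K (-1) ^ q)" by simp
      then have "norm (X K 0) ^ q = norm (X K (-1)) ^ q" by (simp only: norm_power)
      then have "norm (X K 0) = norm (X K (-1))" using q by (auto intro!: power_eq_imp_eq_base[of _ q])
      then show False using \<rho> ln_\<alpha> by (simp add: norm_X)
    qed
  qed auto
  then have "countable (\<Union>K. {w\<in>UNIV. X K w ^ q - 1 = 0})" by blast
  also have "(\<Union>K. {w\<in>UNIV. X K w ^ q - 1 = 0}) = {w. \<exists>K. X K w ^ q = 1}" by auto
  finally show ?thesis .
qed

text \<open>For large \<open>K\<close> the ratio is small on the whole disc. The denominator then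
  stays at least 1/2 in modulus, and \<open>r \<ge> 1\<close> bounds the numerator by the ratio
  itself.\<close>

lemma geo_tail:
  assumes "r \<ge> 1"
  shows "\<exists>C\<ge>0. \<exists>K0. \<forall>K\<ge>K0. \<forall>w\<in>ball w0 1. X K w ^ q \<noteq> 1 \<and> norm (geo r K w) \<le> C * \<bar>\<rho>\<bar> ^ K"
proof -
  \<comment> \<open>\<open>M\<close> bounds the exponential in \<open>norm (X K w)\<close>, since
    \<open>- Re w\<close> is at most \<open>norm w0 + 1\<close> on the disc.\<close>
  define M where "M = exp ((norm w0 + 1) * ln \<alpha>)"
  have M: "M > 0" by (simp add: M_def)
  have XM: "norm (X K w) \<le> M * \<bar>\<rho>\<bar> ^ K" if "w \<in> ball w0 1" for K w
  proof -
    have "norm w \<le> norm w0 + norm (w - w0)" by (metis norm_triangle_sub)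
    then have "- Re w \<le> norm w0 + 1"
      using that abs_Re_le_cmod[of w] by (simp add: dist_norm norm_minus_commute)
    then have "- (Re w * ln \<alpha>) \<le> (norm w0 + 1) * ln \<alpha>"
      using ln_\<alpha> by (metis mult_minus_left mult_right_mono less_imp_le)
    then have "exp (- (Re w * ln \<alpha>)) \<le> M" by (simp add: M_def)
    from mult_left_mono[OF this, of "\<bar>\<rho>\<bar> ^ K"] show ?thesis
      unfolding norm_X by (simp add: mult.commute[of M])
  qed
  obtain K0 where K0: "\<bar>\<rho>\<bar> ^ K0 < 1 / (2 * M)"
    using real_arch_pow_inv[of "1 / (2 * M)" "\<bar>\<rho>\<bar>"] M \<rho> by auto
  have half: "norm (X K w) \<le> 1/2" if "K \<ge> K0" "w \<in> ball w0 1" for K w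
  proof -
    have "M * \<bar>\<rho>\<bar> ^ K \<le> M * \<bar>\<rho>\<bar> ^ K0"
      using that(1) \<rho> M by (intro mult_left_mono power_decreasing) auto
    also have "\<dots> \<le> M * (1 / (2 * M))" using K0 M by (intro mult_left_mono) auto
    also have "\<dots> = 1/2" using M by simp
    finally show ?thesis using XM[OF that(2)] by (meson order_trans)
  qed
  have pow: "norm (X K w) ^ n \<le> norm (X K w)" if "K \<ge> K0" "w \<in> ball w0 1" "n \<ge> 1" for K w n
    using power_decreasing[of 1 n "norm (X K w)"] half[OF that(1,2)] that(3) by simp
  have den: "norm (1 - X K w ^ q) \<ge> 1/2" if "K \<ge> K0" "w \<in> ball w0 1" for K w
  proof -
    have "norm (X K w ^ q) \<le> 1/2" using pow[OF that q] half[OF that] by (simp add: norm_power)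
    then show ?thesis using norm_triangle_ineq2[of 1 "X K w ^ q"] by simp
  qed
  show ?thesis
  proof (intro exI[of _ "2 * M"] exI[of _ K0] conjI allI ballI impI)
    fix K w assume Kw: "K \<ge> K0" "w \<in> ball w0 1"
    show "X K w ^ q \<noteq> 1" using den[OF Kw] by auto
    have "norm (geo r K w) = norm (X K w) ^ r / norm (1 - X K w ^ q)"
      by (simp add: geo_def norm_divide norm_power)
    also have "\<dots> \<le> (M * \<bar>\<rho>\<bar> ^ K) / (1/2)"
      using order_trans[OF pow[OF Kw assms] XM[OF Kw(2)]] den[OF Kw] M by (intro frac_le) auto
    finally show "norm (geo r K w) \<le> 2 * M * \<bar>\<rho>\<bar> ^ K" by simp
  qed (use M in auto)
qed

lemma analytic_geo: "X K w0 ^ q \<noteq> 1 \<Longrightarrow> geo r K analytic_on {w0}"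
  unfolding geo_def[abs_def]
  by (intro analytic_on_divide analytic_on_power analytic_on_diff analytic_on_const analytic_X) auto

lemma dominated_geo:
  assumes "r \<ge> 1" "\<And>K. X K w0 ^ q \<noteq> 1"
  shows "dominated_at \<rho> (geo r) w0"
proof -
  obtain C K0 where "C \<ge> 0" and tail: "\<forall>K\<ge>K0. \<forall>w\<in>ball w0 1. X K w ^ q \<noteq> 1 \<and> norm (geo r K w) \<le> C * \<bar>\<rho>\<bar> ^ K"
    using geo_tail[OF assms(1)] by blast
  then have C: "C \<ge> 0" "\<And>K w. K \<ge> K0 \<Longrightarrow> w \<in> ball w0 1 \<Longrightarrow> X K w ^ q \<noteq> 1"
    "\<And>K w. K \<ge> K0 \<Longrightarrow> w \<in> ball w0 1 \<Longrightarrow> norm (geo r K w) \<le> C * \<bar>\<rho>\<bar> ^ K"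
    by auto
  have "geo r K holomorphic_on ball w0 1" if "K \<ge> K0" for K
    unfolding geo_def[abs_def] by (intro holomorphic_intros) (use C(2)[OF that] in auto)
  then show ?thesis
    using C(1,3) analytic_geo[OF assms(2)] \<rho>(1)
    by (intro dominated_atI[where \<delta> = 1 and C = C and ?K0.0 = K0] zero_less_one) blast+
qed

text \<open>At a pole the function \<open>1 - X K w ^ q\<close> has a simple zero with derivative
  \<open>q * ln \<alpha>\<close>, so dividing out the linear factor leaves an analytic denominator
  that is nonzero there.\<close>

lemma analytic_geo_res: "geo_res w0 r K analytic_on {w0}"
proof (cases "X K w0 ^ q = 1")
  case False
  then have "geo_res w0 r K = (\<lambda>w. (w - w0) * geo r K w)"
    by (auto simp: geo_res_def fun_eq_iff)
  then show ?thesis using analytic_geo[OF False] by (auto intro!: analytic_intros)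
next
  case True
  define f where "f w = 1 - X K w ^ q" for w
  have f': "(f has_field_derivative (of_nat q * of_real (ln \<alpha>) * X K w ^ q)) (at w)" for w
  proof -
    have "(X K has_field_derivative (- of_real (ln \<alpha>) * X K w)) (at w)"
      unfolding X_def[abs_def] by (auto intro!: derivative_eq_intros)
    from DERIV_diff[OF DERIV_const[of 1] DERIV_power[OF this, of q]]
    have "(f has_field_derivative (of_nat q * of_real (ln \<alpha>) * (X K w * X K w ^ (q - Suc 0)))) (at w)"
      unfolding f_def[abs_def] by (simp add: mult.assoc)
    also have "X K w * X K w ^ (q - Suc 0) = X K w ^ q"
      using q by (cases q) auto
    finally show ?thesis .
  qed
  then have "f holomorphic_on UNIV"
    by (meson field_differentiable_at_within field_differentiable_def holomorphic_on_def)
  \<comment> \<open>The difference quotient of \<open>f\<close> at \<open>w0\<close>, completed by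
    the derivative, is entire.\<close>
  define F where "F z = (if z = w0 then deriv f w0 else (f z - f w0) / (z - w0))" for z
  have "F holomorphic_on UNIV"
    unfolding F_def[abs_def] using \<open>f holomorphic_on UNIV\<close> by (rule pole_lemma) auto
  then have an: "F analytic_on {w0}" by (meson analytic_on_holomorphic open_UNIV subset_UNIV)
  have f0: "f w0 = 0" "F w0 = of_nat q * of_real (ln \<alpha>)"
    using True DERIV_imp_deriv[OF f', of w0] by (simp_all add: f_def F_def)
  have "geo_res w0 r K z = X K z ^ r / F z" for z
    using f0 True by (auto simp: geo_res_def F_def geo_def f_def)
  then have "geo_res w0 r K = (\<lambda>z. X K z ^ r / F z)" by blast
  moreover have "F w0 \<noteq> 0" using f0 ln_\<alpha> q by simp
  ultimately show ?thesis using an by (auto intro!: analytic_intros analytic_X)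
qed

text \<open>For large \<open>K\<close> the disc contains no pole and the linear factor has modulus
  below one, so the bound for \<open>geo\<close> carries over.\<close>

lemma dominated_geo_res:
  assumes "r \<ge> 1"
  shows "dominated_at \<rho> (geo_res w0 r) w0"
proof -
  obtain C K0 where "C \<ge> 0" and tail: "\<forall>K\<ge>K0. \<forall>w\<in>ball w0 1. X K w ^ q \<noteq> 1 \<and> norm (geo r K w) \<le> C * \<bar>\<rho>\<bar> ^ K"
    using geo_tail[OF assms(1)] by blast
  then have C: "C \<ge> 0" "\<And>K w. K \<ge> K0 \<Longrightarrow> w \<in> ball w0 1 \<Longrightarrow> X K w ^ q \<noteq> 1"
    "\<And>K w. K \<ge> K0 \<Longrightarrow> w \<in> ball w0 1 \<Longrightarrow> norm (geo r K w) \<le> C * \<bar>\<rho>\<bar> ^ K"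
    by auto
  have eq: "geo_res w0 r K w = (w - w0) * geo r K w" if "K \<ge> K0" "w \<in> ball w0 1" for K w
    using C(2)[OF that] by (auto simp: geo_res_def)
  show ?thesis
  proof (rule dominated_atI[where \<delta> = 1 and C = C and ?K0.0 = K0])
    fix K assume K: "K \<ge> K0"
    have "(\<lambda>w. (w - w0) * geo r K w) holomorphic_on ball w0 1"
      unfolding geo_def[abs_def] by (intro holomorphic_intros) (use C(2)[OF K] in auto)
    then show "geo_res w0 r K holomorphic_on ball w0 1"
      using eq[OF K] by (metis (no_types, lifting) holomorphic_transform)
    fix w assume w: "w \<in> ball w0 1"
    have "norm (w - w0) * norm (geo r K w) \<le> 1 * (C * \<bar>\<rho>\<bar> ^ K)"
      using w C(3)[OF K w] by (intro mult_mono) (auto simp: dist_norm norm_minus_commute)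
    then show "norm (geo_res w0 r K w) \<le> C * \<bar>\<rho>\<bar> ^ K" using eq[OF K w] by (simp add: norm_mult)
  qed (use C \<rho> analytic_geo_res in auto)
qed

text \<open>The point \<open>w\<close> may be a pole, where the quotient has the value
  \<open>0\<close>. Only finitely many indices precede the uniform tail, and a larger constant
  covers them.\<close>

lemma geo_bounded:
  assumes "r \<ge> 1"
  shows "\<exists>C\<ge>0. \<forall>K. norm (geo r K w) \<le> C * \<bar>\<rho>\<bar> ^ K"
proof -
  obtain C K0 where "C \<ge> 0" and tail: "\<forall>K\<ge>K0. \<forall>z\<in>ball w 1. X K z ^ q \<noteq> 1 \<and> norm (geo r K z) \<le> C * \<bar>\<rho>\<bar> ^ K"
    using geo_tail[OF assms] by blast
  then have C: "C \<ge> 0" "\<And>K z. K \<ge> K0 \<Longrightarrow> z \<in> ball w 1 \<Longrightarrow> X K z ^ q \<noteq> 1"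
    "\<And>K z. K \<ge> K0 \<Longrightarrow> z \<in> ball w 1 \<Longrightarrow> norm (geo r K z) \<le> C * \<bar>\<rho>\<bar> ^ K"
    by auto
  define S where "S = (\<Sum>K<K0. norm (geo r K w) / \<bar>\<rho>\<bar> ^ K)"
  have S: "S \<ge> 0" unfolding S_def by (intro sum_nonneg) auto
  have "norm (geo r K w) \<le> (C + S) * \<bar>\<rho>\<bar> ^ K" for K
  proof (cases "K < K0")
    case True
    then have "norm (geo r K w) / \<bar>\<rho>\<bar> ^ K \<le> S" unfolding S_def by (intro member_le_sum) auto
    then have "norm (geo r K w) \<le> S * \<bar>\<rho>\<bar> ^ K" using \<rho> by (simp add: divide_le_eq)
    then show ?thesis using C(1) \<rho> by (simp add: distrib_right add_increasing)
  next
    case False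
    then have "norm (geo r K w) \<le> C * \<bar>\<rho>\<bar> ^ K" using C(3)[of K w] by auto
    then show ?thesis using S by (simp add: distrib_right add_increasing2)
  qed
  then show ?thesis using C(1) S by (intro exI[of _ "C + S"]) auto
qed

text \<open>The continuation of \<open>\<zeta>\<^sub>U\<^sup>e(s | r)\<close>.\<close>

definition zeta_cont :: "nat \<Rightarrow> (nat \<Rightarrow> nat) \<Rightarrow> (nat \<Rightarrow> complex) \<Rightarrow> complex" where
  "zeta_cont e r s = exp (of_real (ln D / 2) * (\<Sum>t=1..e. s t)) * binomial_series e (\<lambda>t. geo (r t)) s"

lemma holo_exp_sum: "openin (Cn e) W \<Longrightarrow> holo e W (\<lambda>s. exp (c * (\<Sum>t=1..e. s t)))"
  by (rule holo_compose[where T = UNIV and g = "\<lambda>x. exp (c * x)"])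
     (auto intro!: holo_sum holo_coord holomorphic_intros)

text \<open>Near \<open>p\<close> every factor is replaced by \<open>geo_res\<close> centred at the
  matching tail sum of \<open>p\<close>. The resulting series is holomorphic near \<open>p\<close>
  and is the original one times the product \<open>h\<close> of the linear factors, which serves as
  denominator.\<close>

lemma meromorphic_zeta_cont_sum:
  assumes "finite R" and r: "\<And>r t. r \<in> R \<Longrightarrow> t \<in> {1..e} \<Longrightarrow> r t \<ge> 1"
  shows "meromorphic_Cn e (\<lambda>s. \<Sum>r\<in>R. A r * zeta_cont e r s)"
  unfolding meromorphic_Cn_iff_local_quotient
proof
  fix p assume p: "p \<in> topspace (Cn e)"
  define \<psi> where "\<psi> r t = geo_res (\<Sum>i=t..e. p i) (r t)" for r t
  have "\<exists>W. p \<in> W \<and> holo e W (binomial_series e (\<psi> r))" if "r \<in> R" for r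
    using holo_binomial_series[OF \<rho>(2) p, of "\<psi> r"] dominated_geo_res r[OF that] unfolding \<psi>_def by metis
  then obtain W where W: "\<And>r. r \<in> R \<Longrightarrow> p \<in> W r" "\<And>r. r \<in> R \<Longrightarrow> holo e (W r) (binomial_series e (\<psi> r))"
    by metis
  define V where "V = (\<Inter>r\<in>R. W r) \<inter> topspace (Cn e)"
  have V: "openin (Cn e) V" unfolding V_def using assms(1) W(2) holo_openin by (intro openin_INT) auto
  have pV: "p \<in> V" using p W by (auto simp: V_def)
  define g where "g s = (\<Sum>r\<in>R. A r * (exp (of_real (ln D / 2) * (\<Sum>t=1..e. s t)) * binomial_series e (\<psi> r) s))" for s
  define h where "h s = (\<Prod>t=1..e. (\<Sum>i=t..e. s i) - (\<Sum>i=t..e. p i))" for s :: "nat \<Rightarrow> complex"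
  have "holo e V g"
    unfolding g_def by (intro holo_sum holo_mult holo_const holo_exp_sum V)
       (use W(2) V in \<open>auto intro!: holo_subset[OF W(2)] simp: V_def\<close>)
  moreover have "holo e V h"
    unfolding h_def by (intro holo_prod holo_diff holo_sum holo_const holo_coord V) auto
  moreover have "\<exists>z\<in>U. h z \<noteq> 0" if U: "openin (Cn e) U" "U \<noteq> {}" for U
  proof -
    obtain s where s: "s \<in> U" using U by blast
    \<comment> \<open>All tail sums are moved at once; the value \<open>0\<close> at
      \<open>Suc e\<close> is the closing condition of the telescope.\<close>
    obtain s' where "s' \<in> U" "\<And>t. t \<in> {1..e} \<Longrightarrow> (\<Sum>i=t..e. s' i) \<notin> {\<Sum>i=t..e. p i}"
      by (rule perturb_tail_sums[OF U(1) s, of "\<lambda>t. {\<Sum>i=t..e. p i}" "\<lambda>t. if t = Suc e then 0 else 1"]) auto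
    then show ?thesis by (intro bexI[of _ s']) (auto simp: h_def)
  qed
  moreover have "(\<Sum>r\<in>R. A r * zeta_cont e r s) = g s / h s" if h: "h s \<noteq> 0" for s
  proof -
    have ne: "(\<Sum>i=t..e. s i) \<noteq> (\<Sum>i=t..e. p i)" if "t \<in> {1..e}" for t
      using h that by (auto simp: h_def)
    have "binomial_series e (\<psi> r) s = h s * binomial_series e (\<lambda>t. geo (r t)) s" for r
    proof -
      have "(\<Prod>t=1..e. \<psi> r t (\<Sum>i=t..e. k i) (\<Sum>i=t..e. s i)) =
        h s * (\<Prod>t=1..e. geo (r t) (\<Sum>i=t..e. k i) (\<Sum>i=t..e. s i))" for k
        unfolding h_def prod.distrib[symmetric]
        by (intro prod.cong) (use ne in \<open>auto simp: \<psi>_def geo_res_def\<close>)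
      then have "binomial_term e (\<psi> r) s k = h s * binomial_term e (\<lambda>t. geo (r t)) s k" for k
        by (simp add: binomial_term_def mult_ac)
      then have "binomial_term e (\<psi> r) s = (\<lambda>k. h s * binomial_term e (\<lambda>t. geo (r t)) s k)" by blast
      then show ?thesis unfolding binomial_series_def by (simp add: infsum_cmult_right')
    qed
    then show ?thesis using h
      by (simp add: g_def zeta_cont_def sum_divide_distrib)
  qed
  ultimately have "local_quotient e (\<lambda>s. \<Sum>r\<in>R. A r * zeta_cont e r s) V g h"
    unfolding local_quotient_def by blast
  then show "\<exists>W g h. p \<in> W \<and> local_quotient e (\<lambda>s. \<Sum>r\<in>R. A r * zeta_cont e r s) W g h" 
    using pV by blast
qed

end

subsection \<open>Expansion of the Lucas series\<close>

text \<open>Both sides multiply \<open>y t ^ l i\<close> over the pairs \<open>i \<le> t\<close>.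
  Regrouping turns partial sums of indices into tail sums of exponents.\<close>

lemma prod_power_partial_sums:
  fixes y :: "nat \<Rightarrow> 'a :: comm_monoid_mult"
  shows "(\<Prod>t=1..e. y t ^ (\<Sum>i=1..t. l i)) = (\<Prod>i=1..e. (\<Prod>t=i..e. y t) ^ l i)"
proof (induction e)
  case (Suc e)
  have "(\<Prod>i=1..Suc e. (\<Prod>t=i..Suc e. y t) ^ l i) =
      (\<Prod>i=1..e. (\<Prod>t=i..Suc e. y t) ^ l i) * y (Suc e) ^ l (Suc e)" by simp
  also have "(\<Prod>i=1..e. (\<Prod>t=i..Suc e. y t) ^ l i) = (\<Prod>i=1..e. (\<Prod>t=i..e. y t) ^ l i * y (Suc e) ^ l i)"
    by (intro prod.cong) (auto simp: power_mult_distrib)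
  finally show ?case using Suc by (simp add: prod.distrib power_add power_sum mult_ac)
qed simp

text \<open>The binomial series for exponent \<open>-s\<close> at \<open>-y\<close>; positivity of
  \<open>1 - y\<close> identifies the complex power with the exponential of a real
  logarithm.\<close>

lemma binomial_has_sum:
  fixes y :: real and s :: complex
  assumes "\<bar>y\<bar> < 1"
  shows "((\<lambda>k. pochhammer s k / fact k * of_real y ^ k) has_sum exp (- s * of_real (ln (1 - y)))) UNIV"
    and "(\<lambda>k. norm (pochhammer s k / fact k * of_real y ^ k)) summable_on UNIV"
proof -
  have "(\<lambda>k. ((-s) gchoose k) * (- of_real y) ^ k) sums (1 + (- of_real y)) powr (- s)"
    using assms by (intro gen_binomial_complex) auto
  also have "(\<lambda>k. ((-s) gchoose k) * (- of_real y) ^ k) = (\<lambda>k. pochhammer s k / fact k * of_real y ^ k)"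
    by (intro ext) (simp add: gbinomial_minus_pochhammer[symmetric] power_minus[of "of_real y"])
  also have "(1 + (- of_real y)) powr (- s) = exp (- s * of_real (ln (1 - y)))"
  proof -
    have "(1 + (- of_real y) :: complex) = of_real (1 - y)" by simp
    moreover have "1 - y > 0" using assms by auto
    ultimately show ?thesis by (simp only: powr_def Ln_of_real) auto
  qed
  finally have sums: "(\<lambda>k. pochhammer s k / fact k * of_real y ^ k) sums exp (- s * of_real (ln (1 - y)))" .
  have "norm (pochhammer s k / fact k * of_real y ^ k) \<le> pochhammer (norm s) k / fact k * \<bar>y\<bar> ^ k" for k
    using norm_pochhammer_le[of s "norm s" k]
    by (simp add: norm_mult norm_divide norm_power mult_right_mono divide_right_mono)
  then show abs: "(\<lambda>k. norm (pochhammer s k / fact k * of_real y ^ k)) summable_on UNIV"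
    by (rule summable_on_comparison_test[OF summable_pochhammer_power[of "norm s" "\<bar>y\<bar>"], rotated 3])
       (use assms in auto)
  show "((\<lambda>k. pochhammer s k / fact k * of_real y ^ k) has_sum exp (- s * of_real (ln (1 - y)))) UNIV"
    by (rule norm_summable_imp_has_sum[OF _ sums]) (use summable_on_imp_summable[OF abs] in simp)
qed

lemma geometric_progression_has_sum:
  fixes x :: complex
  assumes "norm x < 1" "q \<ge> 1"
  shows "((\<lambda>n. x ^ (q * n + r)) has_sum x ^ r / (1 - x ^ q)) UNIV"
    and "(\<lambda>n. norm (x ^ (q * n + r))) summable_on UNIV"
proof -
  have xq: "norm (x ^ q) < 1" using assms by (simp add: norm_power power_less_one_iff)
  have eq: "x ^ (q * n + r) = x ^ r * (x ^ q) ^ n" for n by (simp add: power_add power_mult mult.commute[of _ "x ^ r"])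
  have "summable (\<lambda>n. norm (x ^ q) ^ n)" using xq by (intro summable_geometric) auto
  then have sm: "summable (\<lambda>n. norm (x ^ r * (x ^ q) ^ n))"
    using summable_mult[of _ "norm (x ^ r)"] by (simp add: norm_mult norm_power)
  have "(\<lambda>n. x ^ r * (x ^ q) ^ n) sums (x ^ r * (1 / (1 - x ^ q)))"
    using xq by (intro sums_mult geometric_sums)
  then show "((\<lambda>n. x ^ (q * n + r)) has_sum x ^ r / (1 - x ^ q)) UNIV"
    unfolding eq using norm_summable_imp_has_sum[OF sm] by simp
  show "(\<lambda>n. norm (x ^ (q * n + r))) summable_on UNIV"
    unfolding eq by (subst summable_on_UNIV_nonneg_real_iff) (use sm in auto)
qed

context lucas_factors
begin

text \<open>The Lucas number in terms of \<alpha> and \<rho>: the second root is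
  \<open>\<alpha> * \<rho>\<close> and the difference of the roots is \<open>sqrt D\<close>.\<close>

definition U :: "nat \<Rightarrow> real" where
  "U n = \<alpha> ^ n * (1 - \<rho> ^ n) / sqrt D"

lemma \<rho>_power: "n \<ge> 1 \<Longrightarrow> \<bar>\<rho> ^ n\<bar> < 1"
  using \<rho> by (simp add: power_abs power_less_one_iff)

text \<open>The real logarithm of \<open>U n\<close> splits, which separates the power of
  \<open>D\<close>, the geometric part and the part to be expanded binomially.\<close>

lemma U_powr:
  assumes "n \<ge> 1"
  shows "1 / of_real (U n) powr s = exp (of_real (ln D / 2) * s) * 
    (X 0 s ^ n * exp (- s * of_real (ln (1 - \<rho> ^ n))))"
proof -
  have pos: "1 - \<rho> ^ n > 0" using \<rho>_power[OF assms] by auto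
  then have U: "U n > 0" using \<alpha> D by (simp add: U_def)
  have "ln (U n) = of_nat n * ln \<alpha> + ln (1 - \<rho> ^ n) - ln D / 2"
    unfolding U_def using pos \<alpha> D
    by (simp add: ln_div ln_mult ln_realpow ln_sqrt)
  moreover have "of_real (U n) powr s = exp (s * of_real (ln (U n)))"
    using U by (simp add: powr_def Ln_of_real)
  ultimately have "1 / of_real (U n) powr s = 
      exp (- (s * of_real (of_nat n * ln \<alpha> + ln (1 - \<rho> ^ n) - ln D / 2)))"
    by (simp add: exp_minus inverse_eq_divide)
  also have "- (s * of_real (of_nat n * ln \<alpha> + ln (1 - \<rho> ^ n) - ln D / 2)) =
    of_real (ln D / 2) * s + (of_nat n * (- (s * of_real (ln \<alpha>))) + (- s * of_real (ln (1 - \<rho> ^ n))))"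
    by (simp add: algebra_simps)
  also have "exp \<dots> = exp (of_real (ln D / 2) * s) * (X 0 s ^ n * exp (- s * of_real (ln (1 - \<rho> ^ n))))"
    by (simp only: exp_add exp_of_nat_mult X_def power_0 mult_1)
  finally show ?thesis .
qed

lemma X_mult: "X k s * X k' s' = X (k + k') (s + s')"
proof -
  have "exp (- (s * of_real (ln \<alpha>))) * exp (- (s' * of_real (ln \<alpha>))) = exp (- ((s + s') * of_real (ln \<alpha>)) :: complex)"
    by (simp add: exp_add[symmetric] algebra_simps)
  then show ?thesis unfolding X_def power_add by (metis mult.assoc mult.left_commute)
qed

lemma X_prod: "(\<Prod>t\<in>T. X (k t) (s t)) = X (\<Sum>t\<in>T. k t) (\<Sum>t\<in>T. s t)"
  by (induction T rule: infinite_finite_induct) (simp_all add: X_mult, simp_all add: X_def)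

text \<open>Expanding each factor gives an absolutely summable double family. Summed over
  \<open>k\<close> first it gives back the series, summed over \<open>n\<close> first the binomial
  terms.\<close>

lemma zeta_series_expansion:
  assumes s: "s \<in> conv_domain e" and r: "\<And>t. t \<in> {1..e} \<Longrightarrow> r t \<ge> 1"
  shows "((\<lambda>n. \<Prod>t=1..e. 1 / of_real (U (\<Sum>i=1..t. q * n i + r i)) powr s t) has_sum zeta_cont e r s)
    ({1..e} \<rightarrow>\<^sub>E UNIV)"
proof -
  let ?N = "{1..e} \<rightarrow>\<^sub>E (UNIV :: nat set)"
  define m where "m n t = (\<Sum>i=1..t. q * n i + r i)" for n t
  have m1: "m n t \<ge> 1" if "t \<in> {1..e}" for n t
  proof -
    have "q * n t + r t \<le> m n t" unfolding m_def using that by (intro member_le_sum) auto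
    then show ?thesis using r[OF that] by auto
  qed
  define A where "A n k = (\<Prod>t=1..e. pochhammer (s t) (k t) / fact (k t) * X (k t) (s t) ^ m n t)" for n k
  \<comment> \<open>The modulus of \<alpha> to minus the \<open>i\<close>-th tail sum of
    \<open>s\<close>; on the domain of convergence it is below one.\<close>
  define z where "z i = exp (- ((\<Sum>t=i..e. Re (s t)) * ln \<alpha>))" for i
  have z: "0 < z i" "z i < 1" if "i \<in> {1..e}" for i
    using s that ln_\<alpha> by (auto simp: z_def conv_domain_def)
  have norm_X_tail: "norm (X (\<Sum>t=i..e. k t) (\<Sum>t=i..e. s t)) < 1" if "i \<in> {1..e}" for k i
  proof -
    have "norm (X (\<Sum>t=i..e. k t) (\<Sum>t=i..e. s t)) = \<bar>\<rho>\<bar> ^ (\<Sum>t=i..e. k t) * z i"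
      by (simp add: norm_X z_def)
    also have "\<dots> \<le> 1 * z i" using \<rho> z[OF that] by (intro mult_right_mono power_le_one) auto
    finally show ?thesis using z[OF that] by simp
  qed
  have A_eq: "A n k = (\<Prod>t=1..e. pochhammer (s t) (k t) / fact (k t)) *
     (\<Prod>i=1..e. X (\<Sum>t=i..e. k t) (\<Sum>t=i..e. s t) ^ (q * n i + r i))" for n k
    unfolding A_def m_def prod.distrib prod_power_partial_sums X_prod ..
  have norm_A: "norm (A n k) \<le> (\<Prod>t=1..e. pochhammer (norm (s t)) (k t) / fact (k t) * \<bar>\<rho>\<bar> ^ k t) *
     (\<Prod>i=1..e. z i ^ (q * n i + r i))" for n k
  proof -
    have "norm (A n k) = (\<Prod>t=1..e. norm (pochhammer (s t) (k t) / fact (k t)) * (\<bar>\<rho>\<bar> ^ k t) ^ m n t *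
       exp (- (Re (s t) * ln \<alpha>)) ^ m n t)"
      unfolding A_def prod_norm[symmetric]
      by (intro prod.cong refl) (simp only: norm_mult norm_power norm_X power_mult_distrib mult.assoc)
    also have "\<dots> \<le> (\<Prod>t=1..e. pochhammer (norm (s t)) (k t) / fact (k t) * \<bar>\<rho>\<bar> ^ k t *
       exp (- (Re (s t) * ln \<alpha>)) ^ m n t)"
    proof (intro prod_mono conjI mult_mono)
      fix t assume t: "t \<in> {1..e}"
      show "norm (pochhammer (s t) (k t) / fact (k t)) \<le> pochhammer (norm (s t)) (k t) / fact (k t)"
        using norm_pochhammer_le[of "s t"] by (simp add: norm_divide divide_right_mono)
      \<comment> \<open>Since \<open>m n t \<ge> 1\<close>, the exponent \<open>m n t\<close> may be
        dropped here; this decouples \<open>k\<close> from \<open>n\<close>.\<close>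
      show "(\<bar>\<rho>\<bar> ^ k t) ^ m n t \<le> \<bar>\<rho>\<bar> ^ k t"
        using power_decreasing[of 1 "m n t" "\<bar>\<rho>\<bar> ^ k t"] m1[OF t] \<rho> by (simp add: power_le_one)
    qed (auto intro!: mult_nonneg_nonneg divide_nonneg_nonneg pochhammer_real_nonneg)
    also have "\<dots> = (\<Prod>t=1..e. pochhammer (norm (s t)) (k t) / fact (k t) * \<bar>\<rho>\<bar> ^ k t) *
       (\<Prod>t=1..e. exp (- (Re (s t) * ln \<alpha>)) ^ m n t)"
      by (rule prod.distrib)
    also have "(\<Prod>t=1..e. exp (- (Re (s t) * ln \<alpha>)) ^ m n t) = (\<Prod>i=1..e. z i ^ (q * n i + r i))"
      unfolding m_def prod_power_partial_sums z_def 
      by (simp add: exp_sum[symmetric] sum_negf sum_distrib_right)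
    finally show ?thesis .
  qed
  have sum_A: "(\<lambda>(n, k). A n k) summable_on (?N \<times> ?N)"
  proof -
    define a where "a k = (\<Prod>t=1..e. pochhammer (norm (s t)) (k t) / fact (k t) * \<bar>\<rho>\<bar> ^ k t)" for k
    define b where "b n = (\<Prod>i=1..e. z i ^ (q * n i + r i))" for n
    have a: "a summable_on ?N"
      using summable_pochhammer_PiE[OF \<rho>(2), of e "\<lambda>t. norm (s t)" 1] by (simp add: a_def[abs_def])
    have b: "b summable_on ?N"
      unfolding b_def[abs_def]
    proof (rule summable_on_prod_PiE)
      fix i assume i: "i \<in> {1..e}"
      have "(\<lambda>n. norm (of_real (z i) ^ (q * n + r i) :: complex)) summable_on UNIV"
        by (rule geometric_progression_has_sum(2)) (use z[OF i] q in auto)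
      then show "(\<lambda>n. z i ^ (q * n + r i)) summable_on UNIV" using z[OF i] by (simp add: norm_power)
    qed (auto intro!: zero_le_power less_imp_le[OF z(1)])
    have a0: "a k \<ge> 0" for k unfolding a_def
      by (auto intro!: prod_nonneg mult_nonneg_nonneg divide_nonneg_nonneg pochhammer_real_nonneg)
    have b0: "b n \<ge> 0" for n unfolding b_def by (auto intro!: prod_nonneg zero_le_power less_imp_le[OF z(1)])
    have "(\<lambda>x. norm ((\<lambda>(n, k). A n k) x)) summable_on (?N \<times> ?N)"
    proof (rule summable_on_comparison_test)
      show "(\<lambda>(n, k). b n * a k) summable_on (?N \<times> ?N)"
      proof (rule summable_on_SigmaI[where g = "\<lambda>n. b n * infsum a ?N"])
        show "((\<lambda>k. case (n, k) of (n, k) \<Rightarrow> b n * a k) has_sum b n * infsum a ?N) ?N" for n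
          using a by (auto intro!: has_sum_cmult_right)
        show "(\<lambda>n. b n * infsum a ?N) summable_on ?N" using b by (rule summable_on_cmult_left)
      qed (use a0 b0 in auto)
      show "norm ((\<lambda>(n, k). A n k) x) \<le> (\<lambda>(n, k). b n * a k) x" for x
        using norm_A by (auto simp: a_def b_def mult.commute split: prod.split)
    qed auto
    then show ?thesis by (rule abs_summable_summable)
  qed
  define c where "c = exp (of_real (ln D / 2) * (\<Sum>t=1..e. s t))"
  have sum_k: "(\<Sum>\<^sub>\<infinity>k\<in>?N. A n k) = (\<Prod>t=1..e. X 0 (s t) ^ m n t * exp (- s t * of_real (ln (1 - \<rho> ^ m n t))))" for n
  proof -
    define f where "f t k = pochhammer (s t) k / fact k * X k (s t) ^ m n t" for t k
    have f: "f t k = X 0 (s t) ^ m n t * (pochhammer (s t) k / fact k * of_real (\<rho> ^ m n t) ^ k)" for t k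
      by (simp add: f_def X_def power_mult_distrib power_mult[symmetric] mult_ac)
    have "(\<lambda>k. norm (f t k)) summable_on UNIV" if "t \<in> {1..e}" for t
      using binomial_has_sum(2)[OF \<rho>_power[OF m1[OF that]]]
      unfolding f[abs_def] norm_mult[of "_ ^ _"] by (rule summable_on_cmult_right)
    then have "(\<Sum>\<^sub>\<infinity>k\<in>?N. \<Prod>t=1..e. f t (k t)) = (\<Prod>t=1..e. infsum (f t) UNIV)"
      by (intro infsum_prod_PiE_abs) auto
    also have "\<dots> = (\<Prod>t=1..e. X 0 (s t) ^ m n t * exp (- s t * of_real (ln (1 - \<rho> ^ m n t))))"
    proof (intro prod.cong refl)
      fix t assume t: "t \<in> {1..e}"
      show "infsum (f t) UNIV = X 0 (s t) ^ m n t * exp (- s t * of_real (ln (1 - \<rho> ^ m n t)))"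
        unfolding f[abs_def]
        by (intro infsumI has_sum_cmult_right binomial_has_sum(1) \<rho>_power m1 t)
    qed
    finally show ?thesis by (simp add: A_def f_def)
  qed
  have term_eq: "(\<Prod>t=1..e. 1 / of_real (U (m n t)) powr s t) = c * (\<Sum>\<^sub>\<infinity>k\<in>?N. A n k)" for n
    unfolding sum_k c_def sum_distrib_left exp_sum[OF finite_atLeastAtMost] prod.distrib[symmetric]
    by (intro prod.cong refl U_powr m1)
  \<comment> \<open>After regrouping by increments, the sum over \<open>n\<close> is a product of
    one geometric progression per coordinate.\<close>
  have sum_n: "(\<Sum>\<^sub>\<infinity>n\<in>?N. A n k) = binomial_term e (\<lambda>t. geo (r t)) s k" for k
  proof -
    let ?x = "\<lambda>i. X (\<Sum>t=i..e. k t) (\<Sum>t=i..e. s t)"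
    have "(\<Sum>\<^sub>\<infinity>n\<in>?N. \<Prod>i=1..e. ?x i ^ (q * n i + r i)) = (\<Prod>i=1..e. \<Sum>\<^sub>\<infinity>n. ?x i ^ (q * n + r i))"
      by (rule infsum_prod_PiE_abs) (use geometric_progression_has_sum(2)[OF norm_X_tail q] in auto)
    also have "\<dots> = (\<Prod>i=1..e. geo (r i) (\<Sum>t=i..e. k t) (\<Sum>t=i..e. s t))"
      unfolding geo_def
      by (intro prod.cong refl infsumI geometric_progression_has_sum(1)[OF norm_X_tail q])
    finally show ?thesis unfolding A_eq binomial_term_def by (simp add: infsum_cmult_right')
  qed
  have "(\<lambda>n. \<Sum>\<^sub>\<infinity>k\<in>?N. A n k) summable_on ?N"
    using summable_on_Sigma_banach[OF sum_A] .
  then have "((\<lambda>n. c * (\<Sum>\<^sub>\<infinity>k\<in>?N. A n k)) has_sum c * (\<Sum>\<^sub>\<infinity>n\<in>?N. \<Sum>\<^sub>\<infinity>k\<in>?N. A n k)) ?N"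
    by (intro has_sum_cmult_right has_sum_infsum)
  also have "(\<Sum>\<^sub>\<infinity>n\<in>?N. \<Sum>\<^sub>\<infinity>k\<in>?N. A n k) = binomial_series e (\<lambda>t. geo (r t)) s"
    unfolding infsum_swap_banach[OF sum_A] sum_n binomial_series_def ..
  also have "c * binomial_series e (\<lambda>t. geo (r t)) s = zeta_cont e r s" by (simp add: zeta_cont_def c_def)
  finally have "((\<lambda>n. \<Prod>t=1..e. 1 / of_real (U (m n t)) powr s t) has_sum zeta_cont e r s) ?N"
    unfolding term_eq .
  then show ?thesis unfolding m_def .
qed

end

section \<open>Splitting the increments of the indices into residue classes\<close>

lemma has_sum_finite_Times:
  fixes f :: "'a \<Rightarrow> 'b \<Rightarrow> 'c :: topological_comm_monoid_add"
  assumes "finite R" "\<And>r. r \<in> R \<Longrightarrow> (f r has_sum g r) N"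
  shows "((\<lambda>(r, n). f r n) has_sum (\<Sum>r\<in>R. g r)) (R \<times> N)"
proof -
  have "((\<lambda>(r, n). f r n) has_sum g r) ({r} \<times> N)" if "r \<in> R" for r
  proof -
    have "((\<lambda>(r, n). f r n) has_sum g r) (Pair r ` N)"
      using assms(2)[OF that] by (subst has_sum_reindex) (auto simp: inj_on_def o_def)
    also have "Pair r ` N = {r} \<times> N" by auto
    finally show ?thesis .
  qed
  then have "((\<lambda>(r, n). f r n) has_sum (\<Sum>r\<in>R. g r)) (\<Union>r\<in>R. {r} \<times> N)"
    by (intro sum_has_sum assms(1)) auto
  also have "(\<Union>r\<in>R. {r} \<times> N) = R \<times> N" by auto
  finally show ?thesis .
qed

text \<open>An increasing tuple is determined by its positive increments, and each positive integer
  is uniquely \<open>q * n + r\<close> with \<open>r\<close> in \<open>{1..q}\<close>.\<close>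

lemma bij_betw_residue_increments:
  fixes q d :: nat
  assumes q: "q \<ge> 1"
  shows "bij_betw (\<lambda>(r, n). \<lambda>t\<in>{1..d}. \<Sum>i=1..t. q * n i + r i)
    (({1..d} \<rightarrow>\<^sub>E {1..q}) \<times> ({1..d} \<rightarrow>\<^sub>E UNIV))
    {n \<in> {1..d} \<rightarrow>\<^sub>E {0<..}. strict_mono_on {1..d} n}"
proof -
  \<comment> \<open>The first increment is \<open>l 1\<close> itself; the index \<open>0\<close>
    lies outside the domain of \<open>l\<close>, so \<open>l 0\<close> must not enter.\<close>
  define inc where "inc l i = l i - (if i = 1 then 0 else l (i - 1))" for l :: "nat \<Rightarrow> nat" and i
  let ?j = "\<lambda>(r, n). \<lambda>t\<in>{1..d}. \<Sum>i=1..t. q * n i + r i"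
  \<comment> \<open>Subtracting \<open>1\<close> before the division and adding it to the remainder
    puts the residues into \<open>{1..q}\<close> instead of \<open>{0..<q}\<close>.\<close>
  define g where "g l = (\<lambda>i\<in>{1..d}. (inc l i - 1) mod q + 1, \<lambda>i\<in>{1..d}. (inc l i - 1) div q)" for l
  have inc_pos: "inc l i \<ge> 1" if "l \<in> {1..d} \<rightarrow>\<^sub>E {0<..}" "strict_mono_on {1..d} l" "i \<in> {1..d}" for l i
  proof (cases "i = 1")
    case True
    have "l i \<in> {0<..}" using that by auto
    then show ?thesis using True by (simp add: inc_def)
  next
    case False
    then have "l (i - 1) < l i" using that by (intro strict_mono_onD[OF that(2)]) auto
    then show ?thesis using False by (simp add: inc_def)
  qed
  have tele: "(\<Sum>i=1..t. inc l i) = l t" if "strict_mono_on {1..d} l" "1 \<le> t" "t \<le> d" for l t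
    using that(2,3)
  proof (induction t rule: nat_induct_at_least)
    case base
    then show ?case by (simp add: inc_def)
  next
    case (Suc t)
    have "l t < l (Suc t)" using Suc by (intro strict_mono_onD[OF that(1)]) auto
    then show ?case using Suc by (simp add: inc_def)
  qed
  show ?thesis
  proof (rule bij_betw_byWitness[where f' = g])
    show "\<forall>x\<in>({1..d} \<rightarrow>\<^sub>E {1..q}) \<times> ({1..d} \<rightarrow>\<^sub>E UNIV). g (?j x) = x"
    proof
      fix x assume "x \<in> ({1..d} \<rightarrow>\<^sub>E {1..q}) \<times> ({1..d} \<rightarrow>\<^sub>E (UNIV :: nat set))"
      then obtain r n where x: "x = (r, n)" "r \<in> {1..d} \<rightarrow>\<^sub>E {1..q}" "n \<in> {1..d} \<rightarrow>\<^sub>E UNIV" by auto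
      have inc: "inc (?j x) i = q * n i + r i" if i: "i \<in> {1..d}" for i
      proof (cases i)
        case (Suc i')
        then show ?thesis using i x(1) by (cases "i' = 0") (simp_all add: inc_def)
      qed (use i in auto)
      have *: "(inc (?j x) i - 1) mod q + 1 = r i" "(inc (?j x) i - 1) div q = n i" if i: "i \<in> {1..d}" for i
      proof -
        have "r i \<in> {1..q}" using x(2) i by auto
        then obtain r' where r': "r i = Suc r'" "r' < q" by (cases "r i") auto
        show "(inc (?j x) i - 1) mod q + 1 = r i" "(inc (?j x) i - 1) div q = n i"
          unfolding inc[OF i] using r' q by simp_all
      qed
      have "(\<lambda>i\<in>{1..d}. (inc (?j x) i - 1) mod q + 1) = r"
        using x(2) * by (auto simp: fun_eq_iff PiE_def extensional_def simp del: One_nat_def)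
      moreover have "(\<lambda>i\<in>{1..d}. (inc (?j x) i - 1) div q) = n"
        using x(3) * by (auto simp: fun_eq_iff PiE_def extensional_def simp del: One_nat_def)
      ultimately show "g (?j x) = x" unfolding g_def x(1) by simp
    qed
    show "\<forall>l\<in>{n \<in> {1..d} \<rightarrow>\<^sub>E {0<..}. strict_mono_on {1..d} n}. ?j (g l) = l"
    proof
      fix l assume l: "l \<in> {n \<in> {1..d} \<rightarrow>\<^sub>E {0<..}. strict_mono_on {1..d} (n :: nat \<Rightarrow> nat)}"
      have "(\<Sum>i=1..t. q * snd (g l) i + fst (g l) i) = l t" if t: "t \<in> {1..d}" for t
      proof -
        have "(\<Sum>i=1..t. q * snd (g l) i + fst (g l) i) = (\<Sum>i=1..t. inc l i)"
        proof (intro sum.cong refl)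
          fix i assume "i \<in> {1..t}"
          then have i: "i \<in> {1..d}" using t by auto
          have "q * snd (g l) i + fst (g l) i = q * ((inc l i - 1) div q) + (inc l i - 1) mod q + 1"
            using i by (simp add: g_def)
          also have "\<dots> = inc l i" using inc_pos[of l i] l i by simp
          finally show "q * snd (g l) i + fst (g l) i = inc l i" .
        qed
        also have "\<dots> = l t" using l t by (intro tele) auto
        finally show ?thesis .
      qed
      then have "(\<lambda>t\<in>{1..d}. \<Sum>i=1..t. q * snd (g l) i + fst (g l) i) = l"
        using l by (auto simp: fun_eq_iff PiE_def extensional_def simp del: One_nat_def)
      then show "?j (g l) = l" by (simp add: case_prod_beta)
    qed
    show "?j ` (({1..d} \<rightarrow>\<^sub>E {1..q}) \<times> ({1..d} \<rightarrow>\<^sub>E UNIV)) \<subseteq> {n \<in> {1..d} \<rightarrow>\<^sub>E {0<..}. strict_mono_on {1..d} n}"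
    proof (rule image_subsetI)
      fix x assume "x \<in> ({1..d} \<rightarrow>\<^sub>E {1..q}) \<times> ({1..d} \<rightarrow>\<^sub>E (UNIV :: nat set))"
      then obtain r n where x: "x = (r, n)" and r: "r \<in> {1..d} \<rightarrow>\<^sub>E {1..q}" by auto
      let ?l = "\<lambda>t. \<Sum>i=1..t. q * n i + r i"
      have r1: "r t > 0" if "t \<in> {1..d}" for t using PiE_mem[OF r that] by simp
      have mono: "?l t < ?l u" if "t < u" "u \<le> d" for t u
        by (rule sum_strict_mono2[of _ _ u]) (use that r1[of u] in auto)
      have "?l t > 0" if "t \<in> {1..d}" for t using mono[of 0 t] that by simp
      then show "?j x \<in> {n \<in> {1..d} \<rightarrow>\<^sub>E {0<..}. strict_mono_on {1..d} n}"
        using mono unfolding x by (auto simp: strict_mono_on_def simp del: One_nat_def)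
    qed
    show "g ` {n \<in> {1..d} \<rightarrow>\<^sub>E {0<..}. strict_mono_on {1..d} n} \<subseteq> ({1..d} \<rightarrow>\<^sub>E {1..q}) \<times> ({1..d} \<rightarrow>\<^sub>E UNIV)"
      using q by (auto simp: g_def Suc_le_eq)
  qed
qed

context lucas_factors
begin

text \<open>Modulo \<open>q\<close> each index equals a partial sum of \<open>r\<close>, so by
  periodicity the characters depend on \<open>r\<close> alone and leave the sum over
  \<open>n\<close>.\<close>

lemma L_series_eq:
  assumes s: "s \<in> conv_domain d"
    and chi: "\<And>t a. t \<in> {1..d} \<Longrightarrow> chi t (a + int q) = chi t a"
  shows "(\<Sum>\<^sub>\<infinity>n \<in> {n \<in> {1..d} \<rightarrow>\<^sub>E {0<..}. strict_mono_on {1..d} n}.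
        \<Prod>t=1..d. chi t (int (n t)) / of_real (U (n t)) powr s t) =
    (\<Sum>r \<in> {1..d} \<rightarrow>\<^sub>E {1..q}. (\<Prod>t=1..d. chi t (int (\<Sum>i=1..t. r i))) * zeta_cont d r s)"
proof -
  let ?R = "{1..d} \<rightarrow>\<^sub>E {1..q}" and ?N = "{1..d} \<rightarrow>\<^sub>E (UNIV :: nat set)"
  define j where "j = (\<lambda>(r, n). \<lambda>t\<in>{1..d}. \<Sum>i=1..t. q * n i + r i)"
  define f where "f l = (\<Prod>t=1..d. chi t (int (l t)) / of_real (U (l t)) powr s t)" for l
  define c where "c r = (\<Prod>t=1..d. chi t (int (\<Sum>i=1..t. r i)))" for r
  define g where "g r n = (\<Prod>t=1..d. 1 / of_real (U (\<Sum>i=1..t. q * n i + r i)) powr s t)" for r n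
  have period: "chi t (a + int q * int n) = chi t a" if "t \<in> {1..d}" for t a n
  proof (induction n)
    case (Suc n)
    have "a + int q * int (Suc n) = (a + int q * int n) + int q" by (simp add: algebra_simps)
    then show ?case using chi[OF that] Suc by (simp only:)
  qed simp
  have fj: "f (j (r, n)) = c r * g r n" for r n
  proof -
    have "int (\<Sum>i=1..t. q * n i + r i) = int (\<Sum>i=1..t. r i) + int q * int (\<Sum>i=1..t. n i)" for t
      by (simp add: sum.distrib sum_distrib_left)
    then have "chi t (int (\<Sum>i=1..t. q * n i + r i)) = chi t (int (\<Sum>i=1..t. r i))" if "t \<in> {1..d}" for t
      using period[OF that] by metis
    then show ?thesis
      unfolding f_def j_def c_def g_def prod.distrib[symmetric] by (intro prod.cong) auto
  qed
  have hs: "((\<lambda>n. c r * g r n) has_sum c r * zeta_cont d r s) ?N" if "r \<in> ?R" for r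
    unfolding g_def using that by (intro has_sum_cmult_right zeta_series_expansion[OF s]) auto
  have fin: "finite ?R" by (intro finite_PiE) auto
  have "infsum f {n \<in> {1..d} \<rightarrow>\<^sub>E {0<..}. strict_mono_on {1..d} n} = (\<Sum>\<^sub>\<infinity>x\<in>?R \<times> ?N. f (j x))"
    using infsum_reindex_bij_betw[OF bij_betw_residue_increments[OF q, of d], of f] unfolding j_def ..
  also have "\<dots> = (\<Sum>r\<in>?R. c r * zeta_cont d r s)"
  proof -
    have "(\<lambda>x. f (j x)) = (\<lambda>(r, n). c r * g r n)" by (auto simp: fj)
    then show ?thesis by (simp only:) (rule infsumI, rule has_sum_finite_Times[OF fin hs])
  qed
  finally show ?thesis unfolding f_def[abs_def] c_def .
qed

end

subsection \<open>The residue\<close>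

text \<open>The tail tuple comes first because it will be restricted to a finite set, over which the
  outer sum is taken.\<close>

lemma bij_betw_PiE_merge:
  fixes j d :: nat
  assumes "1 \<le> j" "j \<le> d"
  shows "bij_betw (\<lambda>(k2, k1) i. if i < j then k1 i else k2 i)
    (({j..d} \<rightarrow>\<^sub>E UNIV) \<times> ({1..j - 1} \<rightarrow>\<^sub>E UNIV)) ({1..d} \<rightarrow>\<^sub>E UNIV)"
  by (rule bij_betw_byWitness[where f' = "\<lambda>k. (restrict k {j..d}, restrict k {1..j - 1})"])
     (use assms in \<open>auto simp: PiE_def extensional_def fun_eq_iff\<close>)

lemma head_tail_split:
  fixes j d :: nat
  assumes "t \<le> j" "1 \<le> j" "j \<le> d"
  shows "(\<Sum>i=t..d. f i) = (\<Sum>i=t..j-1. f i) + (\<Sum>i=j..d. f i :: 'a :: comm_monoid_add)"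
    and "(\<Prod>i=t..d. g i) = (\<Prod>i=t..j-1. g i) * (\<Prod>i=j..d. g i :: 'b :: comm_monoid_mult)"
proof -
  have *: "{t..d} = {t..j-1} \<union> {j..d}" "{t..j-1} \<inter> {j..d} = {}" using assms by auto
  show "(\<Sum>i=t..d. f i) = (\<Sum>i=t..j-1. f i) + (\<Sum>i=j..d. f i)"
    unfolding *(1) by (rule sum.union_disjoint) (use *(2) in auto)
  show "(\<Prod>i=t..d. g i) = (\<Prod>i=t..j-1. g i) * (\<Prod>i=j..d. g i)"
    unfolding *(1) by (rule prod.union_disjoint) (use *(2) in auto)
qed

text \<open>The dense subset in the definition lies in the hyperplane, so only the values of
  \<open>R\<close> there enter.\<close>

lemma has_residue_along_cong:
  assumes "has_residue_along F R d j a" "\<And>s. s \<in> tail_hyperplane d j a \<Longrightarrow> R s = R' s"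
  shows "has_residue_along F R' d j a"
proof -
  have "V \<subseteq> tail_hyperplane d j a" if "dense_open_in (subtopology (Cn d) (tail_hyperplane d j a)) V" for V
    using that openin_subset by (fastforce simp: dense_open_in_def)
  note sub = this
  obtain G V V' where GV: "meromorphic_Cn d G"
    "dense_open_in (Cn d) V" "\<forall>s\<in>V. G s = ((\<Sum>i=j..d. s i) - a) * F s"
    "dense_open_in (subtopology (Cn d) (tail_hyperplane d j a)) V'"
    "\<forall>s\<in>V'. (\<exists>W. s \<in> W \<and> holo d W G) \<and> G s = R s"
    using assms(1) unfolding has_residue_along_def by blast
  have "\<forall>s\<in>V'. (\<exists>W. s \<in> W \<and> holo d W G) \<and> G s = R' s"
    using GV(5) sub[OF GV(4)] assms(2) by (metis subsetD)
  then show ?thesis using GV(1-4) unfolding has_residue_along_def by blast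
qed

lemma dense_open_tail_sum_neq:
  assumes j: "j \<in> {1..d}"
  shows "dense_open_in (Cn d) {s \<in> topspace (Cn d). (\<Sum>i=j..d. s i) \<noteq> a}"
  unfolding dense_open_in_iff
proof (intro conjI allI impI)
  have "holo d (topspace (Cn d)) (\<lambda>s. (\<Sum>i=j..d. s i) - a)"
    by (intro holo_diff holo_sum holo_coord holo_const openin_topspace) (use j in auto)
  from holo_nonzero_open[OF this openin_topspace subset_refl]
  show "openin (Cn d) {s \<in> topspace (Cn d). (\<Sum>i=j..d. s i) \<noteq> a}" by simp
  fix T assume T: "openin (Cn d) T \<and> T \<noteq> {}"
  then obtain s where s: "s \<in> T" by blast
  obtain s' where "s' \<in> T" "\<And>t. t \<in> {1..d} \<Longrightarrow> (\<Sum>i=t..d. s' i) \<notin> {a}"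
    by (rule perturb_tail_sums[OF _ s, of d "\<lambda>_. {a}" "\<lambda>t. if t = Suc d then 0 else 1"]) (use T in auto)
  then show "\<exists>z\<in>T. z \<in> {s \<in> topspace (Cn d). (\<Sum>i=j..d. s i) \<noteq> a}"
    using T j openin_subset by blast
qed

context lucas_factors
begin

text \<open>The finite inner sum of the residue formula. The factor of index \<open>j\<close> is
  left out because its residue does not depend on \<open>k\<close>.\<close>

definition residue_sum :: "nat \<Rightarrow> nat \<Rightarrow> nat \<Rightarrow> (nat \<Rightarrow> nat) \<Rightarrow> (nat \<Rightarrow> complex) \<Rightarrow> complex" where
  "residue_sum d j K r s = (\<Sum>k \<in> {k \<in> {j..d} \<rightarrow>\<^sub>E UNIV. (\<Sum>t=j..d. k t) = K}.
     (\<Prod>t=j..d. pochhammer (s t) (k t) / fact (k t)) *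
     (\<Prod>t=j+1..d. geo (r t) (\<Sum>i=t..d. k i) (\<Sum>i=t..d. s i)))"

text \<open>\<open>X\<close> is multiplicative, and a \<open>q\<close>-th root of unity disappears
  from the denominator. This removes the contribution of the tail from the factors of index below
  \<open>j\<close>.\<close>

lemma geo_shift:
  assumes "X K a ^ q = 1"
  shows "geo r (k + K) (w + a) = X K a ^ r * geo r k w"
  unfolding geo_def X_mult[symmetric] power_mult_distrib assms by simp

lemma geo_res_at_pole:
  assumes "X K a ^ q = 1"
  shows "geo_res a r k a = (if k = K then X K a ^ r / (of_nat q * of_real (ln \<alpha>)) else 0)"
  using assms X_power_eq_1_unique by (auto simp: geo_res_def)

text \<open>The factor of index \<open>j\<close>, evaluated at the pole, selects the tuples with
  \<open>j\<close>-th tail sum \<open>K\<close>. The factors below \<open>j\<close> then shift back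
  to those of depth \<open>j - 1\<close>, each leaving a power of \<open>X K a\<close>.\<close>

lemma binomial_series_on_hyperplane:
  assumes j: "1 \<le> j" "j \<le> d" and r: "\<And>t. t \<in> {1..d} \<Longrightarrow> r t \<ge> 1"
    and s: "(\<Sum>i=j..d. s i) = a" and K: "X K a ^ q = 1"
  shows "binomial_series d (\<lambda>t. if t = j then geo_res a (r t) else geo (r t)) s =
    X K a ^ (\<Sum>i=1..j. r i) / (of_nat q * of_real (ln \<alpha>)) *
    binomial_series (j - 1) (\<lambda>t. geo (r t)) (restrict s {1..j - 1}) * residue_sum d j K r s"
proof -
  let ?\<phi> = "\<lambda>t. if t = j then geo_res a (r t) else geo (r t)"
  let ?N1 = "{1..j - 1} \<rightarrow>\<^sub>E (UNIV :: nat set)" and ?N2 = "{j..d} \<rightarrow>\<^sub>E (UNIV :: nat set)"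
  define S where "S = {k \<in> ?N2. (\<Sum>t=j..d. k t) = K}"
  define s1 where "s1 = restrict s {1..j - 1}"
  define C where "C = X K a ^ (\<Sum>i=1..j. r i) / (of_nat q * of_real (ln \<alpha>))"
  define B where "B = binomial_term (j - 1) (\<lambda>t. geo (r t)) s1"
  define T where "T k = (\<Prod>t=j..d. pochhammer (s t) (k t) / fact (k t)) *
     (\<Prod>t=j+1..d. geo (r t) (\<Sum>i=t..d. k i) (\<Sum>i=t..d. s i))" for k :: "nat \<Rightarrow> nat"
  define mg where "mg = (\<lambda>(k2, k1) i. if i < j then k1 i else k2 i :: nat)"
  \<comment> \<open>A merged tuple contributes a tail part times a head part, or nothing at
    all.\<close>
  have mg_term: "binomial_term d ?\<phi> s (mg (k2, k1)) = (if (\<Sum>t=j..d. k2 t) = K then C * T k2 * B k1 else 0)" for k1 k2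
  proof -
    let ?k = "mg (k2, k1)"
    have hi: "(\<Sum>i=t..d. ?k i) = (\<Sum>i=t..d. k2 i)" if "t \<ge> j" for t
      using that by (intro sum.cong) (auto simp: mg_def)
    have lo: "(\<Sum>i=t..j-1. ?k i) = (\<Sum>i=t..j-1. k1 i)" for t
      using j by (intro sum.cong) (auto simp: mg_def)
    have s_lo: "(\<Sum>i=t..j-1. s i) = (\<Sum>i=t..j-1. s1 i)" if "t \<in> {1..j-1}" for t
      using that by (intro sum.cong) (auto simp: s1_def)
    have split_j: "(\<Prod>t=j..d. g t) = g j * (\<Prod>t=j+1..d. g t)" for g :: "nat \<Rightarrow> complex"
      using j by (simp add: prod.atLeast_Suc_atMost)
    have p: "(\<Prod>t=1..d. pochhammer (s t) (?k t) / fact (?k t)) =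
      (\<Prod>t=1..j-1. pochhammer (s1 t) (k1 t) / fact (k1 t)) * (\<Prod>t=j..d. pochhammer (s t) (k2 t) / fact (k2 t))"
      unfolding head_tail_split(2)[OF j(1) j]
      by (intro arg_cong2[of _ _ _ _ "(*)"] prod.cong refl) (auto simp: mg_def s1_def)
    have f2: "(\<Prod>t=j..d. ?\<phi> t (\<Sum>i=t..d. ?k i) (\<Sum>i=t..d. s i)) =
       geo_res a (r j) (\<Sum>i=j..d. k2 i) a * (\<Prod>t=j+1..d. geo (r t) (\<Sum>i=t..d. k2 i) (\<Sum>i=t..d. s i))"
      unfolding split_j using s hi by (auto intro!: prod.cong)
    have f12: "(\<Prod>t=1..d. ?\<phi> t (\<Sum>i=t..d. ?k i) (\<Sum>i=t..d. s i)) =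
       (\<Prod>t=1..j-1. ?\<phi> t (\<Sum>i=t..d. ?k i) (\<Sum>i=t..d. s i)) * (\<Prod>t=j..d. ?\<phi> t (\<Sum>i=t..d. ?k i) (\<Sum>i=t..d. s i))"
      by (rule head_tail_split(2)[OF j(1) j])
    show ?thesis
    proof (cases "(\<Sum>t=j..d. k2 t) = K")
      case False
      then show ?thesis unfolding binomial_term_def f12 f2
        using geo_res_at_pole[OF K] by simp
    next
      case True
      have "(\<Prod>t=1..j-1. ?\<phi> t (\<Sum>i=t..d. ?k i) (\<Sum>i=t..d. s i)) =
        (\<Prod>t=1..j-1. X K a ^ r t * geo (r t) (\<Sum>i=t..j-1. k1 i) (\<Sum>i=t..j-1. s1 i))"
      proof (intro prod.cong refl)
        fix t assume t: "t \<in> {1..j-1}"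
        then have tj: "t \<le> j" "t \<noteq> j" by auto
        have "(\<Sum>i=t..d. ?k i) = (\<Sum>i=t..j-1. k1 i) + K" 
          unfolding head_tail_split(1)[OF tj(1) j] lo hi[OF order_refl] True ..
        moreover have "(\<Sum>i=t..d. s i) = (\<Sum>i=t..j-1. s1 i) + a"
          unfolding head_tail_split(1)[OF tj(1) j] s_lo[OF t] s ..
        ultimately show "?\<phi> t (\<Sum>i=t..d. ?k i) (\<Sum>i=t..d. s i) = 
            X K a ^ r t * geo (r t) (\<Sum>i=t..j-1. k1 i) (\<Sum>i=t..j-1. s1 i)"
          using tj(2) geo_shift[OF K] by simp
      qed
      also have "\<dots> = X K a ^ (\<Sum>t=1..j-1. r t) * (\<Prod>t=1..j-1. geo (r t) (\<Sum>i=t..j-1. k1 i) (\<Sum>i=t..j-1. s1 i))"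
        by (simp add: prod.distrib power_sum)
      finally have f1: "(\<Prod>t=1..j-1. ?\<phi> t (\<Sum>i=t..d. ?k i) (\<Sum>i=t..d. s i)) = \<dots>" .
      have res: "geo_res a (r j) (\<Sum>i=j..d. k2 i) a = X K a ^ r j / (of_nat q * of_real (ln \<alpha>))"
        unfolding True geo_res_at_pole[OF K] by simp
      have "(\<Sum>i=1..j. r i) = (\<Sum>t=1..j-1. r t) + r j" using j by (cases j) auto
      then have C: "C = X K a ^ (\<Sum>t=1..j-1. r t) * (X K a ^ r j / (of_nat q * of_real (ln \<alpha>)))"
        by (simp add: C_def power_add)
      show ?thesis
        unfolding binomial_term_def f12 p f1 f2 res if_P[OF True]
          C B_def T_def by (simp only: mult_ac)
    qed
  qed
  have "binomial_series d ?\<phi> s = (\<Sum>\<^sub>\<infinity>x\<in>?N2 \<times> ?N1. binomial_term d ?\<phi> s (mg x))"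
    unfolding binomial_series_def mg_def
    by (rule infsum_reindex_bij_betw[OF bij_betw_PiE_merge[OF j], symmetric])
  also have "\<dots> = (\<Sum>\<^sub>\<infinity>x\<in>S \<times> ?N1. case x of (k2, k1) \<Rightarrow> C * T k2 * B k1)"
    by (rule infsum_cong_neutral) (auto simp: mg_term S_def split: if_splits)
  also have "\<dots> = (\<Sum>k2\<in>S. C * T k2 * infsum B ?N1)"
  proof (rule infsumI, rule has_sum_finite_Times)
    \<comment> \<open>Natural numbers with sum \<open>K\<close> are at most \<open>K\<close>, which
      bounds the tail tuples.\<close>
    have "S \<subseteq> {j..d} \<rightarrow>\<^sub>E {..K}"
    proof
      fix k assume k: "k \<in> S"
      then have "k t \<le> K" if "t \<in> {j..d}" for t
        using member_le_sum[of t "{j..d}" k] that by (auto simp: S_def)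
      then show "k \<in> {j..d} \<rightarrow>\<^sub>E {..K}" using k by (auto simp: S_def PiE_def Pi_def)
    qed
    then show "finite S" by (rule finite_subset) (auto intro: finite_PiE)
    have "B summable_on ?N1"
      unfolding B_def by (intro summable_binomial_term[OF \<rho>(2)] geo_bounded r) (use j in auto)
    then show "((\<lambda>k1. C * T k2 * B k1) has_sum C * T k2 * infsum B ?N1) ?N1" for k2
      by (intro has_sum_cmult_right) simp
  qed
  also have "\<dots> = C * infsum B ?N1 * (\<Sum>k2\<in>S. T k2)"
    unfolding sum_distrib_left by (intro sum.cong refl) (simp only: mult_ac)
  finally show ?thesis
    by (simp add: C_def B_def T_def S_def s1_def binomial_series_def residue_sum_def)
qed

text \<open>The product of the linear factor and the series is represented by \<open>G\<close>, in
  which only the factor of index \<open>j\<close> is replaced by its extension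
  \<open>geo_res\<close>. On the hyperplane \<open>G\<close> is evaluated by the preceding
  formula.\<close>

lemma has_residue_along_zeta_cont_sum:
  fixes A :: "(nat \<Rightarrow> nat) \<Rightarrow> complex"
  assumes j: "1 \<le> j" "j < d" and K: "X K a ^ q = 1"
    and R: "finite R" "\<And>r t. r \<in> R \<Longrightarrow> t \<in> {1..d} \<Longrightarrow> r t \<ge> 1"
    and L: "dense_open_in (Cn d) VL" "\<And>s. s \<in> VL \<Longrightarrow> L s = (\<Sum>r\<in>R. A r * zeta_cont d r s)"
    and Z: "\<And>r. r \<in> R \<Longrightarrow> dense_open_in (Cn (j - 1)) (VZ r)"
      "\<And>r s. r \<in> R \<Longrightarrow> s \<in> VZ r \<Longrightarrow> Z r s = zeta_cont (j - 1) r s"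
  shows "has_residue_along L (\<lambda>s. exp (of_real (ln D / 2) * a) *
    (\<Sum>r\<in>R. A r * Z r (restrict s {1..j - 1}) * residue_sum d j K r s *
       (X K a ^ (\<Sum>i=1..j. r i) / (of_nat q * of_real (ln \<alpha>))))) d j a"
proof -
  let ?F = "\<lambda>s. \<Sum>r\<in>R. A r * zeta_cont d r s"
  let ?H = "tail_hyperplane d j a"
  let ?l = "\<lambda>s. (\<Sum>i=j..d. s i) - a"
  define \<phi> where "\<phi> r t = (if t = j then geo_res a (r t) else geo (r t))" for r :: "nat \<Rightarrow> nat" and t
  define G where "G s = (\<Sum>r\<in>R. A r * (exp (of_real (ln D / 2) * (\<Sum>t=1..d. s t)) * binomial_series d (\<phi> r) s))" for s
  have jd: "j \<in> {1..d}" "j \<le> d" using j by auto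
  have G_off: "G s = ?l s * ?F s" if "?l s \<noteq> 0" for s
  proof -
    have "binomial_series d (\<phi> r) s = ?l s * binomial_series d (\<lambda>t. geo (r t)) s" for r
    proof -
      have "(\<Prod>t=1..d. \<phi> r t (\<Sum>i=t..d. k i) (\<Sum>i=t..d. s i)) =
        (\<Prod>t=1..d. (if t = j then ?l s else 1) * geo (r t) (\<Sum>i=t..d. k i) (\<Sum>i=t..d. s i))" for k
        by (intro prod.cong) (use that in \<open>auto simp: \<phi>_def geo_res_def\<close>)
      also have "\<dots> k = ?l s * (\<Prod>t=1..d. geo (r t) (\<Sum>i=t..d. k i) (\<Sum>i=t..d. s i))" for k
        unfolding prod.distrib using jd by (simp add: prod.delta)
      finally have "binomial_term d (\<phi> r) s = (\<lambda>k. ?l s * binomial_term d (\<lambda>t. geo (r t)) s k)"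
        by (simp add: binomial_term_def fun_eq_iff mult_ac)
      then show ?thesis unfolding binomial_series_def by (simp add: infsum_cmult_right')
    qed
    then show ?thesis
      by (simp add: G_def zeta_cont_def sum_distrib_left mult_ac)
  qed
  have l_holo: "holo d (topspace (Cn d)) ?l"
    by (intro holo_diff holo_sum holo_coord holo_const openin_topspace) (use j in auto)
  have mF: "meromorphic_Cn d ?F" using R by (intro meromorphic_zeta_cont_sum) auto
  have G_mero: "meromorphic_Cn d G"
  proof (rule meromorphic_Cn_holo_mult_ae[OF mF l_holo])
    show "\<exists>z\<in>V. ?l z \<noteq> 0" if V: "openin (Cn d) V" "V \<noteq> {}" for V
    proof -
      obtain z where "z \<in> V" "z \<in> {s \<in> topspace (Cn d). (\<Sum>i=j..d. s i) \<noteq> a}"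
        using dense_open_tail_sum_neq[OF jd(1), of a] V unfolding dense_open_in_iff by meson
      then show ?thesis by auto
    qed
  qed (use G_off in auto)
  \<comment> \<open>The \<open>j\<close>-th factor is already extended across the hyperplane, so
    only the poles of the other factors have to be avoided.\<close>
  have G_holo: "\<exists>W. p \<in> W \<and> holo d W G" if p: "p \<in> topspace (Cn d)" "(\<Sum>i=j..d. p i) = a"
    "\<And>t k. t \<in> {1..d} \<Longrightarrow> t \<noteq> j \<Longrightarrow> X k (\<Sum>i=t..d. p i) ^ q \<noteq> 1" for p
  proof -
    have "\<exists>W. p \<in> W \<and> holo d W (binomial_series d (\<phi> r))" if "r \<in> R" for r
    proof -
      have "dominated_at \<rho> (\<phi> r t) (\<Sum>i=t..d. p i)" if "t \<in> {1..d}" for t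
        using dominated_geo_res[of "r t" a] dominated_geo[of "r t"] R(2)[OF \<open>r \<in> R\<close> that] p that
        by (auto simp: \<phi>_def)
      then show ?thesis using holo_binomial_series[OF \<rho>(2) p(1)] by metis
    qed
    then obtain W where W: "\<And>r. r \<in> R \<Longrightarrow> p \<in> W r" "\<And>r. r \<in> R \<Longrightarrow> holo d (W r) (binomial_series d (\<phi> r))"
      by metis
    define V where "V = (\<Inter>r\<in>R. W r) \<inter> topspace (Cn d)"
    have V: "openin (Cn d) V" unfolding V_def using R(1) W(2) holo_openin by (intro openin_INT) auto
    have "holo d V G"
      unfolding G_def by (intro holo_sum holo_mult holo_const holo_exp_sum V)
         (use W(2) V in \<open>auto intro!: holo_subset[OF W(2)] simp: V_def\<close>)
    moreover have "p \<in> V" using p W by (auto simp: V_def)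
    ultimately show ?thesis by blast
  qed
  define VZ' where "VZ' = topspace (Cn (j - 1)) \<inter> (\<Inter>r\<in>R. VZ r)"
  have VZ': "dense_open_in (Cn (j - 1)) VZ'" unfolding VZ'_def by (rule dense_open_in_INT[OF R(1) Z(1)])
  \<comment> \<open>Points whose head lies where every \<open>Z r\<close> agrees with the explicit
    continuation.\<close>
  define pre where "pre = {s \<in> topspace (Cn d). restrict s {1..j - 1} \<in> VZ'}"
  have pre: "openin (Cn d) pre"
    unfolding pre_def
  proof (rule openin_continuous_map_preimage[where Y = "Cn (j - 1)"])
    show "continuous_map (Cn d) (Cn (j - 1)) (\<lambda>s. restrict s {1..j - 1})"
      using j by (intro continuous_map_into_Cn) (auto intro!: continuous_map_Cn_coord)
  qed (use VZ' in \<open>simp add: dense_open_in_def\<close>)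
  have G_on: "G s = exp (of_real (ln D / 2) * a) *
    (\<Sum>r\<in>R. A r * Z r (restrict s {1..j - 1}) * residue_sum d j K r s *
       (X K a ^ (\<Sum>i=1..j. r i) / (of_nat q * of_real (ln \<alpha>))))" if s: "s \<in> ?H" "s \<in> pre" for s
  proof -
    have sa: "(\<Sum>i=j..d. s i) = a" using s by (simp add: tail_hyperplane_def)
    let ?c = "of_real (ln D / 2) :: complex"
    let ?C = "\<lambda>r. X K a ^ (\<Sum>i=1..j. r i) / (of_nat q * of_real (ln \<alpha>))"
    have e1: "exp (?c * (\<Sum>t=1..d. s t)) = exp (?c * a) * exp (?c * (\<Sum>t=1..j-1. restrict s {1..j-1} t))"
      unfolding head_tail_split(1)[OF j(1) j(1) jd(2)] sa exp_add[symmetric] by (simp add: algebra_simps)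
    have e2: "Z r (restrict s {1..j - 1}) = zeta_cont (j - 1) r (restrict s {1..j - 1})" if "r \<in> R" for r
      using Z(2)[OF that] s(2) that by (auto simp: pre_def VZ'_def)
    have e3: "binomial_series d (\<phi> r) s = ?C r *
      binomial_series (j - 1) (\<lambda>t. geo (r t)) (restrict s {1..j - 1}) * residue_sum d j K r s" if "r \<in> R" for r
      unfolding \<phi>_def by (rule binomial_series_on_hyperplane[OF j(1) jd(2) R(2)[OF that] sa K])
    show ?thesis
      unfolding G_def sum_distrib_left[of _ _ R]
    proof (intro sum.cong refl)
      fix r assume "r \<in> R"
      show "A r * (exp (?c * (\<Sum>t=1..d. s t)) * binomial_series d (\<phi> r) s) = exp (?c * a) *
         (A r * Z r (restrict s {1..j - 1}) * residue_sum d j K r s * ?C r)"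
        unfolding e1 e2[OF \<open>r \<in> R\<close>] e3[OF \<open>r \<in> R\<close>] zeta_cont_def by (simp only: mult_ac)
    qed
  qed
  define V where "V = ?H \<inter> (\<Union>{W. holo d W G} \<inter> pre)"
  have "dense_open_in (subtopology (Cn d) ?H) V"
    unfolding dense_open_in_iff
  proof (intro conjI allI impI)
    have "openin (Cn d) (\<Union>{W. holo d W G} \<inter> pre)" using pre holo_openin by blast
    then show "openin (subtopology (Cn d) ?H) V" unfolding V_def openin_subtopology by blast
    fix T assume T: "openin (subtopology (Cn d) ?H) T \<and> T \<noteq> {}"
    then obtain T0 where T0: "openin (Cn d) T0" "T = T0 \<inter> ?H" by (auto simp: openin_subtopology)
    then obtain s where s: "s \<in> T0" "s \<in> ?H" using T by blast
    have s_top: "s \<in> topspace (Cn d)" and sa: "(\<Sum>i=j..d. s i) = a" 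
      using s by (auto simp: tail_hyperplane_def)
    \<comment> \<open>First move: \<open>m\<close> changes only coordinates below \<open>j\<close>,
      so it keeps the \<open>j\<close>-th tail sum while the head is brought into
      \<open>VZ'\<close>.\<close>
    define m where "m z = (\<lambda>i. if i \<in> {1..j-1} then z i else s i)" for z :: "nat \<Rightarrow> complex"
    have m: "continuous_map (Cn (j - 1)) (Cn d) m"
    proof (rule continuous_map_into_Cn)
      fix i assume "i \<in> {1..d}"
      show "continuous_map (Cn (j - 1)) euclidean (\<lambda>z. m z i)"
        by (cases "i \<in> {1..j-1}") (auto simp: m_def intro!: continuous_map_Cn_coord)
    qed (use s_top j in \<open>auto simp: m_def PiE_def extensional_def\<close>)
    have "openin (Cn (j - 1)) {z \<in> topspace (Cn (j - 1)). m z \<in> T0}"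
      by (rule openin_continuous_map_preimage[OF m T0(1)])
    moreover have "m (restrict s {1..j - 1}) = s" by (auto simp: m_def)
    then have "restrict s {1..j - 1} \<in> {z \<in> topspace (Cn (j - 1)). m z \<in> T0}" using s by simp
    ultimately obtain z where z: "z \<in> topspace (Cn (j - 1))" "m z \<in> T0" "z \<in> VZ'"
      using VZ' unfolding dense_open_in_iff by (metis (mono_tags, lifting) empty_iff mem_Collect_eq)
    have "restrict (m z) {1..j - 1} = z" using z(1) by (auto simp: m_def PiE_def extensional_def fun_eq_iff)
    then have mz: "m z \<in> T0 \<inter> pre"
      using z subsetD[OF openin_subset[OF T0(1)] z(2)] by (simp add: pre_def)
    have mza: "(\<Sum>i=j..d. m z i) = a" unfolding sa[symmetric] by (intro sum.cong) (use j in \<open>auto simp: m_def\<close>)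
    have Opre: "openin (Cn d) (T0 \<inter> pre)" using T0(1) pre by blast
    \<comment> \<open>Second move: the zero of the direction at \<open>j\<close> keeps the point on
      the hyperplane, and all other tail sums leave the countable set of poles.\<close>
    obtain s' where s': "s' \<in> T0 \<inter> pre" "\<And>t. t \<in> {1..d} \<Longrightarrow> (if t = j \<or> t = Suc d then 0 else 1::complex) = 0 \<Longrightarrow> (\<Sum>i=t..d. s' i) = (\<Sum>i=t..d. m z i)"
      "\<And>t. t \<in> {1..d} \<Longrightarrow> (if t = j \<or> t = Suc d then 0 else 1::complex) \<noteq> 0 \<Longrightarrow> (\<Sum>i=t..d. s' i) \<notin> {w. \<exists>k. X k w ^ q = 1}"
      by (rule perturb_tail_sums[OF Opre mz, of "\<lambda>t. {w. \<exists>k. X k w ^ q = 1}" "\<lambda>t. if t = j \<or> t = Suc d then 0 else 1"])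
         (use countable_poles in auto)
    have s'a: "(\<Sum>i=j..d. s' i) = a" using s'(2)[OF jd(1)] mza by simp
    have s'_top: "s' \<in> topspace (Cn d)" using s'(1) T0(1) openin_subset by blast
    have "\<exists>W. s' \<in> W \<and> holo d W G"
      using s'(3) by (intro G_holo s'_top s'a) auto
    then have "s' \<in> V" using s'(1) s'a s'_top by (auto simp: V_def tail_hyperplane_def)
    moreover have "s' \<in> T" using s'(1) s'a s'_top T0(2) by (auto simp: tail_hyperplane_def)
    ultimately show "\<exists>z\<in>T. z \<in> V" by blast
  qed
  moreover have "\<forall>s\<in>V. (\<exists>W. s \<in> W \<and> holo d W G) \<and> G s = exp (of_real (ln D / 2) * a) *
    (\<Sum>r\<in>R. A r * Z r (restrict s {1..j - 1}) * residue_sum d j K r s *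
       (X K a ^ (\<Sum>i=1..j. r i) / (of_nat q * of_real (ln \<alpha>))))"
    using G_on unfolding V_def by blast
  moreover have "dense_open_in (Cn d) (VL \<inter> {s \<in> topspace (Cn d). (\<Sum>i=j..d. s i) \<noteq> a})"
    by (intro dense_open_in_Int L dense_open_tail_sum_neq jd)
  moreover have "\<forall>s\<in>VL \<inter> {s \<in> topspace (Cn d). (\<Sum>i=j..d. s i) \<noteq> a}. G s = ?l s * L s"
    using G_off L(2) by auto
  ultimately show ?thesis unfolding has_residue_along_def using G_mero by blast
qed

end

section \<open>Identification with the continuations of the Lucas series\<close>

lemma conv_domain_open: "openin (Cn m) (conv_domain m)"
proof -
  have "openin (Cn m) {s \<in> topspace (Cn m). (\<Sum>i=t..m. Re (s i)) \<in> {0<..}}" if t: "t \<in> {1..m}" for t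
  proof (rule openin_continuous_map_preimage[where Y = euclidean])
    have "continuous_map euclidean euclidean Re" by (simp add: continuous_on_Re continuous_on_id)
    then have "continuous_map (Cn m) euclidean (\<lambda>s. Re (s i))" if "i \<in> {t..m}" for i
      using continuous_map_compose[OF continuous_map_Cn_coord, of i m euclidean Re] that t by (simp add: o_def)
    then show "continuous_map (Cn m) euclidean (\<lambda>s. \<Sum>i=t..m. Re (s i))"
      by (intro continuous_map_sum) auto
  qed auto
  then have "openin (Cn m) ((\<Inter>t\<in>{1..m}. {s \<in> topspace (Cn m). (\<Sum>i=t..m. Re (s i)) \<in> {0<..}}) \<inter> topspace (Cn m))"
    by (intro openin_INT) auto
  also have "(\<Inter>t\<in>{1..m}. {s \<in> topspace (Cn m). (\<Sum>i=t..m. Re (s i)) \<in> {0<..}}) \<inter> topspace (Cn m) = conv_domain m"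
    unfolding conv_domain_def by auto
  finally show ?thesis .
qed

lemma conv_domain_nonempty: "conv_domain m \<noteq> {}"
proof -
  have "(\<lambda>i\<in>{1..m}. 1) \<in> conv_domain m"
    unfolding conv_domain_def by (auto intro!: sum_pos)
  then show ?thesis by blast
qed

context lucas_factors
begin

lemma zeta_cont_0: "zeta_cont 0 r s = 1"
  by (simp add: zeta_cont_def binomial_series_def binomial_term_def)

text \<open>\<open>zeta_cont\<close> is meromorphic and equals the series on the domain of
  convergence. Depth zero is separate because \<open>lucas_zeta\<close> is then the constant
  \<open>1\<close> by definition.\<close>

lemma lucas_zeta_ae:
  assumes U: "\<And>n. lucas_U P Q n = U n" and r: "\<And>t. t \<in> {1..e} \<Longrightarrow> r t \<ge> 1"
  shows "\<exists>V. dense_open_in (Cn e) V \<and> (\<forall>s\<in>V. lucas_zeta P Q q e r s = zeta_cont e r s)"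
proof (cases "e = 0")
  case True
  then show ?thesis
    by (intro exI[of _ "topspace (Cn e)"] conjI dense_open_in_topspace)
       (simp add: lucas_zeta_def zeta_cont_0)
next
  case False
  have mero: "meromorphic_Cn e (zeta_cont e r)"
    using meromorphic_zeta_cont_sum[of "{r}" e "\<lambda>_. 1"] r by simp
  have eq: "zeta_cont e r s = lucas_zeta_series P Q q e r s" if "s \<in> conv_domain e" for s
    using infsumI[OF zeta_series_expansion[OF that r]]
    by (simp add: lucas_zeta_series_def U sum.distrib sum_distrib_left)
  have "lucas_zeta P Q q e r = meromorphic_continuation e (conv_domain e) (lucas_zeta_series P Q q e r)"
    using False by (simp add: lucas_zeta_def)
  then show ?thesis
    using meromorphic_continuation_ae[OF mero eq conv_domain_open conv_domain_nonempty] by metis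
qed

lemma lucas_L_ae:
  assumes U: "\<And>n. lucas_U P Q n = U n" and chi: "\<And>t. t \<in> {1..d} \<Longrightarrow> dirichlet_character q (chi t)"
  shows "\<exists>V. dense_open_in (Cn d) V \<and> (\<forall>s\<in>V. lucas_L P Q d chi s =
    (\<Sum>r \<in> {1..d} \<rightarrow>\<^sub>E {1..q}. (\<Prod>t=1..d. chi t (int (\<Sum>i=1..t. r i))) * zeta_cont d r s))"
proof -
  let ?F = "\<lambda>s. \<Sum>r \<in> {1..d} \<rightarrow>\<^sub>E {1..q}. (\<Prod>t=1..d. chi t (int (\<Sum>i=1..t. r i))) * zeta_cont d r s"
  have mero: "meromorphic_Cn d ?F"
    by (rule meromorphic_zeta_cont_sum) (auto intro: finite_PiE)
  have eq: "?F s = lucas_L_series P Q d chi s" if "s \<in> conv_domain d" for s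
  proof -
    have "chi t (a + int q) = chi t a" if "t \<in> {1..d}" for t a
      using chi[OF that] by (simp add: dirichlet_character_def)
    then show ?thesis
      unfolding lucas_L_series_def U by (intro L_series_eq[OF that, symmetric]) auto
  qed
  show ?thesis
  proof (rule meromorphic_continuation_ae[OF mero eq conv_domain_open conv_domain_nonempty])
    fix V assume "dense_open_in (Cn d) V" "\<And>s. s \<in> V \<Longrightarrow>
      meromorphic_continuation d (conv_domain d) (lucas_L_series P Q d chi) s = ?F s"
    then show ?thesis unfolding lucas_L_def by blast
  qed
qed

text \<open>Since \<open>Q = \<rho> * \<alpha>\<^sup>2\<close>, the extra \<open>2 * k\<close> in
  the exponent turns \<open>Q ^ k\<close> into \<open>\<rho> ^ k\<close>.\<close>

lemma X_power:
  assumes "\<rho> = Q / \<alpha>\<^sup>2"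
  shows "of_real Q ^ (k * r) * of_real \<alpha> powr (- of_nat r * (w + 2 * of_nat k)) = X k w ^ r"
proof -
  have "X k w = of_real Q ^ k * exp (- (w + 2 * of_nat k) * of_real (ln \<alpha>))"
  proof -
    have "exp (of_nat (2 * k) * of_real (ln \<alpha>)) = (of_real (\<alpha> ^ (2 * k)) :: complex)"
      unfolding exp_of_nat_mult using \<alpha> by (simp add: exp_of_real)
    moreover have "Q = \<rho> * \<alpha>\<^sup>2" using \<alpha> assms by simp
    then have "(of_real Q ^ k :: complex) = of_real \<rho> ^ k * of_real (\<alpha> ^ (2 * k))"
      by (simp add: power_mult_distrib power_mult)
    ultimately have "(of_real Q ^ k :: complex) = of_real \<rho> ^ k * exp (of_nat (2 * k) * of_real (ln \<alpha>))"
      by simp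
    then have "of_real \<rho> ^ k = of_real Q ^ k * exp (- (2 * of_nat k) * of_real (ln \<alpha>) :: complex)"
      by (simp add: exp_minus)
    moreover have "exp (- (w + 2 * of_nat k) * of_real (ln \<alpha>)) =
       exp (- (2 * of_nat k) * of_real (ln \<alpha>)) * exp (- (w * of_real (ln \<alpha>)))"
      unfolding exp_add[symmetric] by (simp add: algebra_simps)
    ultimately show ?thesis by (simp only: X_def mult.assoc)
  qed
  moreover have "of_real \<alpha> powr (- of_nat r * (w + 2 * of_nat k)) = 
      (exp (- (w + 2 * of_nat k) * of_real (ln \<alpha>)) :: complex) ^ r"
  proof -
    have "of_real \<alpha> powr (- of_nat r * (w + 2 * of_nat k)) =
        exp (- of_nat r * (w + 2 * of_nat k) * of_real (ln \<alpha>))"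
      using \<alpha> by (simp add: powr_def Ln_of_real)
    also have "- of_nat r * (w + 2 * of_nat k) * of_real (ln \<alpha>) = of_nat r * (- (w + 2 * of_nat k) * of_real (ln \<alpha>) :: complex)"
      by (simp add: algebra_simps)
    also have "exp \<dots> = exp (- (w + 2 * of_nat k) * of_real (ln \<alpha>)) ^ r" by (rule exp_of_nat_mult)
    finally show ?thesis .
  qed
  ultimately show ?thesis by (simp add: power_mult_distrib power_mult)
qed

text \<open>The real part of the pole cancels the modulus of \<open>\<rho> ^ K\<close>, the term
  with \<open>ell\<close> cancels its sign when \<open>Q < 0\<close>, and the term with
  \<open>n\<close> leaves a power of the root of unity.\<close>

lemma X_pole_value:
  assumes "\<rho> = Q / \<alpha>\<^sup>2" "\<alpha> = lucas_alpha P Q"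
  shows "X K (pole_value P Q q n K) = root_of_unity q powi (- n)"
proof -
  have Q0: "Q \<noteq> 0" using \<rho> assms by auto
  define l where "l = complex_of_real (ln \<alpha>)"
  have l0: "l \<noteq> 0" using ln_\<alpha> by (simp add: l_def)
  let ?a = "pole_value P Q q n K"
  have "- (?a * l) = of_nat K * (2 * l - of_real (ln \<bar>Q\<bar>)) - of_int n * (2 * of_real pi * \<i> / of_nat q)
      - of_nat (ell Q K) * (of_real pi * \<i>)"
    unfolding pole_value_def assms(2)[symmetric] l_def[symmetric] of_real_divide
    using l0 by (simp add: field_simps)
  then have "exp (- (?a * l)) = exp (of_nat K * (2 * l - of_real (ln \<bar>Q\<bar>))) /
      exp (of_int n * (2 * of_real pi * \<i> / of_nat q)) / exp (of_nat (ell Q K) * (of_real pi * \<i>))"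
    by (simp only: exp_diff)
  also have "exp (of_nat K * (2 * l - of_real (ln \<bar>Q\<bar>))) = of_real ((\<alpha>\<^sup>2 / \<bar>Q\<bar>) ^ K)"
  proof -
    have "exp (2 * l - of_real (ln \<bar>Q\<bar>)) = of_real (exp (2 * ln \<alpha> - ln \<bar>Q\<bar>))"
      by (simp add: l_def flip: exp_of_real)
    also have "exp (2 * ln \<alpha> - ln \<bar>Q\<bar>) = \<alpha>\<^sup>2 / \<bar>Q\<bar>"
      using \<alpha> Q0 by (simp add: exp_diff exp_double)
    finally show ?thesis by (simp add: exp_of_nat_mult)
  qed
  also have "exp (of_int n * (2 * of_real pi * \<i> / of_nat q)) = root_of_unity q powi n"
    unfolding root_of_unity_def by (rule exp_power_int[symmetric])
  also have "exp (of_nat (ell Q K) * (of_real pi * \<i>)) = (-1) ^ ell Q K"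
    unfolding exp_of_nat_mult by simp
  finally have "X K ?a = of_real (\<rho> ^ K * (\<alpha>\<^sup>2 / \<bar>Q\<bar>) ^ K) / (-1) ^ ell Q K / root_of_unity q powi n"
    by (simp add: X_def l_def)
  also have "\<rho> ^ K * (\<alpha>\<^sup>2 / \<bar>Q\<bar>) ^ K = (-1) ^ ell Q K"
  proof -
    have "\<rho> ^ K * (\<alpha>\<^sup>2 / \<bar>Q\<bar>) ^ K = (Q / \<bar>Q\<bar>) ^ K"
      unfolding power_mult_distrib[symmetric] assms(1) using \<alpha> by simp
    also have "\<dots> = (-1) ^ ell Q K" using Q0 by (cases "Q < 0") (auto simp: ell_def)
    finally show ?thesis .
  qed
  finally show ?thesis by (simp add: power_int_minus divide_inverse)
qed

end

section \<open>The conditions on the parameters and the residue formula\<close>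

lemma lucas_factorsI:
  fixes P Q :: real
  assumes "P > 0" "Q \<noteq> 0" "P \<le> 2 \<Longrightarrow> Q < P - 1" "P > 2 \<Longrightarrow> Q \<le> P - 1" "q \<ge> 1"
  shows "lucas_factors (lucas_alpha P Q) (Q / (lucas_alpha P Q)\<^sup>2) (lucas_disc P Q) q"
    and "lucas_beta P Q = lucas_alpha P Q * (Q / (lucas_alpha P Q)\<^sup>2)"
proof -
  define D where "D = lucas_disc P Q"
  define \<alpha> where "\<alpha> = lucas_alpha P Q"
  \<comment> \<open>The difference \<open>D - (P - 2)\<^sup>2\<close> equals
    \<open>4 * (P - 1 - Q)\<close>, so the bounds on \<open>Q\<close> compare \<open>sqrt D\<close>
    with \<open>\<bar>P - 2\<bar>\<close>.\<close>
  have sq: "(P - 2)\<^sup>2 \<le> D" "P \<le> 2 \<Longrightarrow> (P - 2)\<^sup>2 < D"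
    using assms(3,4) by (auto simp: D_def lucas_disc_def power2_eq_square algebra_simps) (cases "P \<le> 2"; simp)
  have D: "D > 0"
  proof (cases "P \<le> 2")
    case True
    then show ?thesis using sq(2) by (smt (verit) zero_le_power2)
  next
    case False
    then have "(P - 2)\<^sup>2 > 0" by simp
    then show ?thesis using sq(1) by linarith
  qed
  have \<alpha>: "\<alpha> > 1"
  proof (cases "P \<le> 2")
    case True
    then have "sqrt ((P - 2)\<^sup>2) < sqrt D" using sq(2) real_sqrt_less_mono by blast
    then show ?thesis using True by (simp add: \<alpha>_def lucas_alpha_def D_def[symmetric])
  next
    case False
    \<comment> \<open>For \<open>P > 2\<close> this gives
      \<open>\<alpha> \<ge> P - 1 > 1\<close>.\<close>
    then have "sqrt ((P - 2)\<^sup>2) \<le> sqrt D" using sq(1) real_sqrt_le_mono by blast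
    then show ?thesis using False by (simp add: \<alpha>_def lucas_alpha_def D_def[symmetric])
  qed
  have prod: "\<alpha> * lucas_beta P Q = Q"
    using D by (simp add: \<alpha>_def lucas_alpha_def lucas_beta_def D_def[symmetric] field_simps)
       (simp add: D_def lucas_disc_def power2_eq_square)
  then show beta: "lucas_beta P Q = lucas_alpha P Q * (Q / (lucas_alpha P Q)\<^sup>2)"
    unfolding \<alpha>_def[symmetric] using \<alpha> by (simp add: power2_eq_square field_simps)
  have "\<bar>lucas_beta P Q\<bar> < \<alpha>"
    using D assms(1) by (simp add: \<alpha>_def lucas_alpha_def lucas_beta_def D_def[symmetric] abs_less_iff)
  then have "\<alpha> * \<bar>Q / \<alpha>\<^sup>2\<bar> < \<alpha> * 1"
    using beta \<alpha> by (simp add: \<alpha>_def[symmetric] abs_mult)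
  then have "\<bar>Q / \<alpha>\<^sup>2\<bar> < 1" using \<alpha> by (simp only: mult_less_cancel_left_pos)
  then show "lucas_factors (lucas_alpha P Q) (Q / (lucas_alpha P Q)\<^sup>2) (lucas_disc P Q) q"
    using \<alpha> D assms(2,5) unfolding \<alpha>_def[symmetric] D_def[symmetric] by unfold_locales auto
qed

theorem theorem9:
  fixes P Q :: real and d j q :: nat and n :: int
    and chi :: "nat \<Rightarrow> int \<Rightarrow> complex" and k' :: "nat \<Rightarrow> nat"
    and \<alpha> D :: real and a :: complex
  assumes "P > 0" and "Q \<noteq> 0"
    and "P \<le> 2 \<Longrightarrow> Q < P - 1" and "P > 2 \<Longrightarrow> Q \<le> P - 1"
    and "d \<ge> 2" and "1 \<le> j" and "j \<le> d - 1"
    and "q \<ge> 2"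
    and "\<And>t. t \<in> {1..d} \<Longrightarrow> dirichlet_character q (chi t)"
    and "\<alpha> = lucas_alpha P Q" and "D = lucas_disc P Q"
    and "a = pole_value P Q q n (\<Sum>t=j..d. k' t)"
  shows "has_residue_along (lucas_L P Q d chi)
    (\<lambda>s. of_real D powr (a / 2) *
      (\<Sum>r \<in> {1..d} \<rightarrow>\<^sub>E {1..q}.
        (\<Prod>t=1..d. chi t (int (\<Sum>i=1..t. r i))) *
        lucas_zeta P Q q (j - 1) r (restrict s {1..j - 1}) *
        (\<Sum>k \<in> {k \<in> {j..d} \<rightarrow>\<^sub>E UNIV. (\<Sum>t=j..d. k t) = (\<Sum>t=j..d. k' t)}.
          (\<Prod>t=j..d. ((- s t) gchoose k t) * (-1) ^ k t) *
          (\<Prod>t=j+1..d.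
             of_real Q ^ ((\<Sum>i=t..d. k i) * r t) *
             of_real \<alpha> powr (- of_nat (r t) * ((\<Sum>i=t..d. s i) + 2 * of_nat (\<Sum>i=t..d. k i))) /
             (1 - of_real Q ^ (q * (\<Sum>i=t..d. k i)) *
                  of_real \<alpha> powr (- of_nat q * ((\<Sum>i=t..d. s i) + 2 * of_nat (\<Sum>i=t..d. k i))))) *
          (root_of_unity q powi (- n * int (\<Sum>i=1..j. r i)) / (of_nat q * of_real (ln \<alpha>))))))
    d j a"
proof -
  define \<rho> where "\<rho> = Q / \<alpha>\<^sup>2"
  define K where "K = (\<Sum>t=j..d. k' t)"
  note lf = lucas_factorsI[OF assms(1-4), of q]
  have beta: "lucas_beta P Q = \<alpha> * \<rho>"
    unfolding \<rho>_def assms(10) using assms(8) by (intro lf(2)) auto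
  interpret lucas_factors \<alpha> \<rho> D q
    unfolding \<rho>_def assms(10,11) using assms(8) by (intro lf(1)) auto
  have "lucas_alpha P Q - lucas_beta P Q = sqrt D"
    by (simp add: lucas_alpha_def lucas_beta_def assms(11) field_simps)
  \<comment> \<open>The second root is \<open>\<alpha> * \<rho>\<close>, so the powers of \<alpha>
    factor out of the Lucas quotient.\<close>
  then have U: "lucas_U P Q m = U m" for m
    unfolding lucas_U_def U_def beta by (simp add: assms(10)[symmetric] power_mult_distrib algebra_simps)
  have jd: "1 \<le> j" "j < d" using assms(5-7) by auto
  have Xa: "X K a = root_of_unity q powi (- n)"
    unfolding assms(12) K_def[symmetric] by (rule X_pole_value[OF \<rho>_def assms(10)])
  have root: "root_of_unity q ^ q = 1"
  proof -
    have "root_of_unity q ^ q = exp (of_nat q * (2 * of_real pi * \<i> / of_nat q))"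
      unfolding root_of_unity_def exp_of_nat_mult ..
    also have "\<dots> = 1" using q by simp
    finally show ?thesis .
  qed
  \<comment> \<open>Thus \<open>a\<close> is a pole of the geometric factor with index
    \<open>K\<close>, as the residue computation requires.\<close>
  have Xaq: "X K a ^ q = 1"
    unfolding Xa using root by (metis power_int_1_left power_int_mult power_int_of_nat mult.commute)
  let ?R = "{1..d} \<rightarrow>\<^sub>E {1..q}"
  have r1: "r t \<ge> 1" if "r \<in> ?R" "t \<in> {1..d}" for r t using PiE_mem[OF that] by simp
  obtain VL where "dense_open_in (Cn d) VL" "\<forall>s\<in>VL. lucas_L P Q d chi s =
    (\<Sum>r \<in> ?R. (\<Prod>t=1..d. chi t (int (\<Sum>i=1..t. r i))) * zeta_cont d r s)"
    using lucas_L_ae[of P Q d chi] U assms(9) by blast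
  then have VL: "dense_open_in (Cn d) VL" "\<And>s. s \<in> VL \<Longrightarrow> lucas_L P Q d chi s =
    (\<Sum>r \<in> ?R. (\<Prod>t=1..d. chi t (int (\<Sum>i=1..t. r i))) * zeta_cont d r s)" by auto
  have "\<exists>V. dense_open_in (Cn (j - 1)) V \<and> (\<forall>s\<in>V. lucas_zeta P Q q (j - 1) r s = zeta_cont (j - 1) r s)"
    if "r \<in> ?R" for r
    by (rule lucas_zeta_ae[OF U r1[OF that]]) (use jd in auto)
  then obtain VZ where VZ: "\<And>r. r \<in> ?R \<Longrightarrow> dense_open_in (Cn (j - 1)) (VZ r)"
    "\<And>r s. r \<in> ?R \<Longrightarrow> s \<in> VZ r \<Longrightarrow> lucas_zeta P Q q (j - 1) r s = zeta_cont (j - 1) r s"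
    by metis
  have fin: "finite ?R" by (intro finite_PiE) auto
  have main: "has_residue_along (lucas_L P Q d chi) (\<lambda>s. exp (of_real (ln D / 2) * a) *
    (\<Sum>r\<in>?R. (\<Prod>t=1..d. chi t (int (\<Sum>i=1..t. r i))) *
        lucas_zeta P Q q (j - 1) r (restrict s {1..j - 1}) * residue_sum d j K r s *
        (X K a ^ (\<Sum>i=1..j. r i) / (of_nat q * of_real (ln \<alpha>))))) d j a"
    by (rule has_residue_along_zeta_cont_sum[where VL = VL and VZ = VZ, OF jd Xaq fin])
       (use r1 VL VZ in blast)+
  show ?thesis
  proof (rule has_residue_along_cong[OF main])
    fix s :: "nat \<Rightarrow> complex"
    have powr: "exp (of_real (ln D / 2) * a) = of_real D powr (a / 2)"
      using D by (simp add: powr_def Ln_of_real mult.commute)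
    have root_pow: "X K a ^ m = root_of_unity q powi (- n * int m)" for m
      unfolding Xa by (simp only: power_int_mult power_int_of_nat)
    \<comment> \<open>What remains is notation: \<open>X\<close> is written through \<open>Q\<close>
      and \<alpha>, and rising factorials become signed binomial coefficients.\<close>
    have res: "residue_sum d j K r s = (\<Sum>k \<in> {k \<in> {j..d} \<rightarrow>\<^sub>E UNIV. (\<Sum>t=j..d. k t) = K}.
          (\<Prod>t=j..d. ((- s t) gchoose k t) * (-1) ^ k t) *
          (\<Prod>t=j+1..d.
             of_real Q ^ ((\<Sum>i=t..d. k i) * r t) *
             of_real \<alpha> powr (- of_nat (r t) * ((\<Sum>i=t..d. s i) + 2 * of_nat (\<Sum>i=t..d. k i))) /
             (1 - of_real Q ^ (q * (\<Sum>i=t..d. k i)) *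
                  of_real \<alpha> powr (- of_nat q * ((\<Sum>i=t..d. s i) + 2 * of_nat (\<Sum>i=t..d. k i))))))" for r
      unfolding residue_sum_def geo_def X_power[OF \<rho>_def, symmetric] gbinomial_minus_pochhammer
        mult.commute[of q] ..
    show "exp (of_real (ln D / 2) * a) * (\<Sum>r\<in>?R. (\<Prod>t=1..d. chi t (int (\<Sum>i=1..t. r i))) *
        lucas_zeta P Q q (j - 1) r (restrict s {1..j - 1}) * residue_sum d j K r s *
        (X K a ^ (\<Sum>i=1..j. r i) / (of_nat q * of_real (ln \<alpha>)))) = of_real D powr (a / 2) *
      (\<Sum>r \<in> {1..d} \<rightarrow>\<^sub>E {1..q}.
        (\<Prod>t=1..d. chi t (int (\<Sum>i=1..t. r i))) *
        lucas_zeta P Q q (j - 1) r (restrict s {1..j - 1}) *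
        (\<Sum>k \<in> {k \<in> {j..d} \<rightarrow>\<^sub>E UNIV. (\<Sum>t=j..d. k t) = (\<Sum>t=j..d. k' t)}.
          (\<Prod>t=j..d. ((- s t) gchoose k t) * (-1) ^ k t) *
          (\<Prod>t=j+1..d.
             of_real Q ^ ((\<Sum>i=t..d. k i) * r t) *
             of_real \<alpha> powr (- of_nat (r t) * ((\<Sum>i=t..d. s i) + 2 * of_nat (\<Sum>i=t..d. k i))) /
             (1 - of_real Q ^ (q * (\<Sum>i=t..d. k i)) *
                  of_real \<alpha> powr (- of_nat q * ((\<Sum>i=t..d. s i) + 2 * of_nat (\<Sum>i=t..d. k i))))) *
          (root_of_unity q powi (- n * int (\<Sum>i=1..j. r i)) / (of_nat q * of_real (ln \<alpha>)))))"
      unfolding powr res root_pow K_def[symmetric] by (simp only: mult.assoc sum_distrib_right)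
  qed
qed

end
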